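(* Assume $\sup_{t\in\mathcal{T}}\|A_t\|_2\le 1$. Let $\beta>20\sigma^2$ and set \[\gamma=\frac{\beta-12\sigma^2-\sqrt{\beta-4\sigma^2}\sqrt{\beta-20\sigma^2}}{16\sigma^2}.\] If for every $t\in\mathcal{T}$ \[\mathrm{pen}(t)\ge\frac{4\sigma^2}{\beta-4\sigma^2}\,\sigma^2\,\mathrm{Tr}(A_t^2),\] then: (i) for any $\eta\in(0,1]$, with probability at least $1-\eta$, \[\|f_0-f_{EWA}\|_2^2\le\inf_{\mu\in\mathcal{M}_+^1(\mathcal{T})}\Big\{\Big(1+\frac{4\gamma}{1-2\gamma}\Big)\int\|f_0-\hat f_t\|_2^2\,d\mu(t)+\Big(1+\frac{2\gamma}{1-2\gamma}\Big)\int\big(\mathrm{pen}(t)+2\sigma^2\mathrm{Tr}(A_t)\big)d\mu(t)+\beta\Big(1+\frac{2\gamma}{1-2\gamma}\Big)\Big(2\,\mathrm{KL}(\mu,\pi)+\ln\frac1\eta\Big)\Big\};\] (ii) furthermore, \[\mathbb{E}\|f_0-f_{EWA}\|_2^2\le\inf_{\mu\in\mathcal{M}_+^1(\mathcal{T})}\Big\{\Big(1+\frac{4\gamma}{1-2\gamma}\Big)\int\mathbb{E}\|f_0-\hat f_t\|_2^2\,d\mu(t)+\Big(1+\frac{2\gamma}{1-2\gamma}\Big)\int\big(\mathrm{pen}(t)+2\sigma^2\mathrm{Tr}(A_t)\big)d\mu(t)+2\beta\Big(1+\frac{2\gamma}{1-2\gamma}\Big)\mathrm{KL}(\mu,\p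i)\Big\}.\]
   Context: Model: one observes $Y=f_0+W\in\mathbb{R}^n$, i.e. $Y_i=f_0(x_i)+W_i$ at fixed design points $x_1,\dots,x_n$; the unknown function $f_0$ is identified with the deterministic vector $(f_0(x_i))_{i=1}^n\in\mathbb{R}^n$. The noise $W$ is a random vector in $\mathbb{R}^n$ (coordinates not assumed independent) with $\mathbb{E}(W)=0$ and, for a known $\sigma^2>0$, $\mathbb{E}[\exp(\alpha^\top W)]\le\exp(\frac{\sigma^2}{2}\|\alpha\|_2^2)$ for all $\alpha\in\mathbb{R}^n$. For vectors $\|\cdot\|_2$ is the Euclidean norm; for matrices $\|\cdot\|_2$ is the operator (spectral) norm. Estimators: $\mathcal{T}$ is a measurable space (not necessarily countable). For $t\in\mathcal{T}$, $A_t$ is a (deterministic) real symmetric positive semi-definite $n\times n$ matrix, $b_t\in\mathbb{R}^n$, and $b\in\mathbb{R}^n$ is a fixed common recentring vector; $\hat f_t=\hat f_t(Y)=A_t(Y-b)+b+b_t$. Aggregate: $\mathrm{pen}:\mathcal{T}\to\mathbb{R}$ is a deterministic penalty, $\pi$ a prior probability measure on $\mathcal{T}$, $\beta>0$ the temperature. The maps $t\mapsto A_t,b_t,\mathrm{pen}(t)$ are measurable. Set $r_t=\|Y-\hat f_t(Y)\|_2^2+2\sigma^2\mathrm{Tr}(A_t)-n\sigma^2$ and $\widetilde r_t=r_t+\mathrm{pen}(t)$. Define the probability measure $d\rho_{EWA}(t)=\frac{\exp(-\widetilde r_t/\beta)}{\int\exp(-\widetilde r_{t'}/\beta)\,d\pi(t')}\,d\pi(t)$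 and the exponentially weighted aggregate $f_{EWA}=\int\hat f_t\,d\rho_{EWA}(t)$. $\mathcal{M}_+^1(\mathcal{T})$ is the set of probability measures on $\mathcal{T}$; $\mathrm{KL}(\mu,\pi)$ is the Kullback–Leibler divergence, $\int\ln\frac{d\mu}{d\pi}\,d\mu$ if $\mu\ll\pi$ and $+\infty$ otherwise. *)

theory Defs
  imports "HOL-Probability.Probability"
begin

definition pos_semidef :: "real^'n^'n \<Rightarrow> bool" where
  "pos_semidef A \<longleftrightarrow> transpose A = A \<and> (\<forall>x. 0 \<le> x \<bullet> (A *v x))"

text \<open>
  The measurable space of indices is given by \<open>T :: 't measure\<close>, of which only the
  \<open>\<sigma>\<close>-algebra matters; probability measures on it are the elements of
  \<open>space (prob_algebra T)\<close>. In the estimators, \<open>b\<close> is the common recentring vector, \<open>c t\<close> is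
  the individual shift (written \<open>b\<^sub>t\<close> in the mathematics), and \<open>y\<close> is the observation.
\<close>

definition affine_est ::
  "('t \<Rightarrow> real^'n^'n) \<Rightarrow> real^'n \<Rightarrow> ('t \<Rightarrow> real^'n) \<Rightarrow> real^'n \<Rightarrow> 't \<Rightarrow> real^'n" where
  "affine_est A b c y t = A t *v (y - b) + b + c t"

definition risk_est ::
  "real \<Rightarrow> ('t \<Rightarrow> real^'n^'n) \<Rightarrow> real^'n \<Rightarrow> ('t \<Rightarrow> real^'n) \<Rightarrow> real^'n \<Rightarrow> 't \<Rightarrow> real" where
  "risk_est \<sigma> A b c y t =
     (norm (y - affine_est A b c y t))\<^sup>2 + 2 * \<sigma>\<^sup>2 * trace (A t) - real CARD('n) * \<sigma>\<^sup>2"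

definition pen_risk_est ::
  "real \<Rightarrow> ('t \<Rightarrow> real) \<Rightarrow> ('t \<Rightarrow> real^'n^'n) \<Rightarrow> real^'n \<Rightarrow> ('t \<Rightarrow> real^'n) \<Rightarrow> real^'n \<Rightarrow> 't \<Rightarrow> real" where
  "pen_risk_est \<sigma> pen A b c y t = risk_est \<sigma> A b c y t + pen t"

text \<open>
  The integrals in the next two definitions converge when \<open>pen\<close> and \<open>trace (A t)\<close> are
  nonnegative: for fixed \<open>y\<close> the weight is then at most a constant times
  \<open>exp (- (norm (y - affine_est A b c y t))\<^sup>2 / \<beta>)\<close>, so that both the weight and its product
  with \<open>affine_est A b c y t\<close> are bounded in \<open>t\<close>.
\<close>

definition ewa_measure ::
  "'t measure \<Rightarrow> real \<Rightarrow> real \<Rightarrow> ('t \<Rightarrow> real) \<Rightarrow> ('t \<Rightarrow> real^'n^'n) \<Rightarrow> real^'n \<Rightarrow> ('t \<Rightarrow> real^'n)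
    \<Rightarrow> real^'n \<Rightarrow> 't measure" where
  "ewa_measure \<pi> \<beta> \<sigma> pen A b c y =
     density \<pi> (\<lambda>t. ennreal (exp (- pen_risk_est \<sigma> pen A b c y t / \<beta>)
                    / (\<integral>t'. exp (- pen_risk_est \<sigma> pen A b c y t' / \<beta>) \<partial>\<pi>)))"

definition ewa ::
  "'t measure \<Rightarrow> real \<Rightarrow> real \<Rightarrow> ('t \<Rightarrow> real) \<Rightarrow> ('t \<Rightarrow> real^'n^'n) \<Rightarrow> real^'n \<Rightarrow> ('t \<Rightarrow> real^'n)
    \<Rightarrow> real^'n \<Rightarrow> real^'n" where
  "ewa \<pi> \<beta> \<sigma> pen A b c y = (\<integral>t. affine_est A b c y t \<partial>(ewa_measure \<pi> \<beta> \<sigma> pen A b c y))"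

text \<open>
  Extended Kullback--Leibler divergence of \<open>\<mu>\<close> with respect to \<open>\<pi>\<close>. The library's
  \<open>KL_divergence\<close> is real-valued and takes the reference measure first. By
  \<open>entropy_density_negative_part\<close> below, the log-density can fail to be integrable only
  because its positive part has infinite integral, in which case the divergence is \<open>\<infinity>\<close>.
\<close>

definition kl_div :: "'t measure \<Rightarrow> 't measure \<Rightarrow> ereal" where
  "kl_div \<mu> \<pi> =
     (if absolutely_continuous \<pi> \<mu> \<and> integrable \<mu> (entropy_density (exp 1) \<pi> \<mu>)
      then ereal (KL_divergence (exp 1) \<pi> \<mu>) else \<infinity>)"

lemma entropy_density_negative_part:
  assumes "prob_space \<pi>" "sets \<mu> = sets \<pi>" "absolutely_continuous \<pi> \<mu>" "prob_space \<mu>"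
  shows "(\<integral>\<^sup>+ t. ennreal (- entropy_density (exp 1) \<pi> \<mu> t) \<partial>\<mu>) < \<infinity>"
proof -
  interpret prob_space \<pi> by fact
  let ?d = "RN_deriv \<pi> \<mu>"
  have \<mu>: "density \<pi> ?d = \<mu>"
    using assms by (intro density_RN_deriv) auto
  have le: "?d t * ennreal (- entropy_density (exp 1) \<pi> \<mu> t) \<le> 1" for t
  proof (cases "?d t")
    case (real r)
    have "r * (- ln r) \<le> 1"
    proof (cases "r = 0")
      case False
      with real have "r > 0" by simp
      then have "ln (1 / r) \<le> 1 / r - 1" by (intro ln_le_minus_one) simp
      then have "- ln r \<le> 1 / r" using \<open>r > 0\<close> by (simp add: ln_div)
      then have "r * (- ln r) \<le> r * (1 / r)" using \<open>r > 0\<close> by (intro mult_left_mono) auto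
      then show ?thesis using \<open>r > 0\<close> by simp
    qed simp
    then have "ennreal (r * (- ln r)) \<le> 1" by (simp only: ennreal_le_1)
    moreover have "ennreal (r * (- ln r)) = ennreal r * ennreal (- ln r)"
      using real by (intro ennreal_mult') simp
    ultimately have "ennreal r * ennreal (- ln r) \<le> 1" by (simp only:)
    then show ?thesis
      using real by (simp add: entropy_density_def log_def)
  qed (simp add: entropy_density_def log_def)
  have "(\<integral>\<^sup>+ t. ennreal (- entropy_density (exp 1) \<pi> \<mu> t) \<partial>(density \<pi> ?d))
      = (\<integral>\<^sup>+ t. ?d t * ennreal (- entropy_density (exp 1) \<pi> \<mu> t) \<partial>\<pi>)"
    by (intro nn_integral_density) (auto simp: entropy_density_def)
  also have "\<dots> \<le> (\<integral>\<^sup>+ t. 1 \<partial>\<pi>)"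
    by (intro nn_integral_mono le)
  also have "\<dots> < \<infinity>" by (simp add: emeasure_space_1)
  finally show ?thesis using \<mu> by simp
qed

end

theory Submission
  imports Defs
begin

text \<open>
  Write \<open>f t\<close> for the estimators, \<open>D t = |f0 - f t|\<^sup>2\<close> for their losses and
  \<open>p t = pen t + 2 \<sigma>\<^sup>2 trace (A t)\<close>. Everything is controlled by one random variable, the prior
  average over pairs
  \<open>X = \<integral>\<integral> exp ((2 W \<bullet> (f t - f s) - p t - 2 \<gamma> (D t + D s)) / \<beta>) d\<pi>(t) d\<pi>(s)\<close>.

  On the one hand, \<open>X\<close> has expectation at most one, because this holds for each pair \<open>(s, t)\<close>
  (\<open>pair_exponential_moment_le_1\<close>). The exponent is a quadratic polynomial in the noise whose
  quadratic part is at most \<open>2 W \<bullet> (A t *v W) / \<beta>\<close>. For sub-Gaussian noise such an exponential is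
  bounded by its Gaussian value (\<open>subgaussian_exp_quadratic\<close>), and in an eigenbasis of \<open>A t\<close> this
  value is governed by the traces of \<open>A t\<close> and its square, which \<open>p t\<close> compensates by the
  condition on the penalty. What is linear in the noise is compensated by the terms with \<open>\<gamma>\<close>,
  since \<open>2 \<sigma>\<^sup>2 (1 + 2 \<gamma>)\<^sup>2 = \<gamma> (\<beta> - 4 \<sigma>\<^sup>2)\<close>.

  On the other hand, \<open>X\<close> bounds the loss of the aggregate for every realisation of the noise
  (\<open>exp_weighted_mean_bound\<close>). The scalar product with the noise is a difference of empirical
  risks up to terms in \<open>D\<close> and \<open>p\<close>, so the exponent separates in \<open>s\<close> and \<open>t\<close> and \<open>X\<close> is a product of
  two integrals. By the inequalities of Jensen, Cauchy--Schwarz and Donsker--Varadhan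
  \<open>(1 - 2 \<gamma>) |f0 - f_EWA|\<^sup>2 \<le> (1 + 2 \<gamma>) \<integral> D d\<mu> + \<integral> p d\<mu> + 2 \<beta> KL(\<mu>, \<pi>) + \<beta> ln X\<close>
  for every \<open>\<mu>\<close>. As \<open>X\<close> does not depend on \<open>\<mu>\<close>, Markov's inequality for \<open>X\<close> gives the bound in
  probability for all \<open>\<mu>\<close> at once, and \<open>ln X \<le> X - 1\<close> gives the bound in expectation.

  The infimum over \<open>\<mu>\<close> runs over an uncountable set, and the event in the first bound has to be
  shown measurable. The bound for each \<open>\<mu>\<close> is, as a function of the noise vector, either constantly
  infinite or continuous, so the infimum is upper semicontinuous
  (\<open>borel_measurable_INF_upper_semicontinuous\<close>, \<open>open_mean_square_sublevel\<close>).
\<close>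

section \<open>Orthonormal eigenbases of symmetric matrices\<close>

text \<open>
  The spectral theorem, stated for invariant subspaces so that it can be proved by induction on
  the dimension: a maximiser of the quadratic form on the unit sphere of \<open>S\<close> is an eigenvector,
  and its orthogonal complement in \<open>S\<close> is again invariant. The eigenvalue of a unit eigenvector
  \<open>e\<close> is written \<open>e \<bullet> f e\<close>.
\<close>
lemma self_adjoint_orthonormal_eigenbasis:
  fixes f :: "'a::euclidean_space \<Rightarrow> 'a"
  assumes lin: "linear f" and adj: "\<And>x y. f x \<bullet> y = x \<bullet> f y"
    and S: "subspace S" "\<And>x. x \<in> S \<Longrightarrow> f x \<in> S"
  shows "\<exists>B. finite B \<and> B \<subseteq> S \<and> pairwise orthogonal B \<and> span B = S
           \<and> (\<forall>e\<in>B. norm e = 1 \<and> f e = (e \<bullet> f e) *\<^sub>R e)"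
  using S
proof (induction "dim S" arbitrary: S rule: less_induct)
  case less
  interpret linear f by (rule lin)
  show ?case
  proof (cases "S = {0}")
    case True
    then show ?thesis by (intro exI[of _ "{}"]) auto
  next
    case False
    let ?K = "S \<inter> sphere 0 1"
    obtain x where x: "x \<in> S" "x \<noteq> 0"
      using False subspace_0[OF less.prems(1)] by auto
    then have "x /\<^sub>R norm x \<in> ?K"
      using less.prems(1) by (auto simp: subspace_scale)
    moreover have "compact ?K"
      using closed_Int_compact[OF closed_subspace[OF less.prems(1)] compact_sphere] .
    moreover have "continuous_on ?K (\<lambda>x. x \<bullet> f x)"
      by (intro continuous_intros linear_continuous_on lin[unfolded linear_conv_bounded_linear])
    ultimately obtain e where e: "e \<in> ?K" and max: "\<And>y. y \<in> ?K \<Longrightarrow> y \<bullet> f y \<le> e \<bullet> f e"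
      using continuous_attains_sup[of ?K "\<lambda>x. x \<bullet> f x"] by blast
    define m where "m = e \<bullet> f e"
    have eS: "e \<in> S" and ne: "norm e = 1" using e by auto
    have ee: "e \<bullet> e = 1" using ne by (simp add: dot_square_norm)
    have q: "y \<bullet> f y \<le> m * (y \<bullet> y)" if "y \<in> S" for y
    proof (cases "y = 0")
      case False
      have "y /\<^sub>R norm y \<in> ?K" using that False less.prems(1) by (auto simp: subspace_scale)
      from max[OF this] have "(y \<bullet> f y) / (norm y)\<^sup>2 \<le> m"
        by (simp add: m_def scaleR power2_eq_square divide_simps)
      then show ?thesis using False by (simp add: divide_simps dot_square_norm)
    qed simp
    define u where "u = f e - m *\<^sub>R e"
    have uS: "u \<in> S"
      unfolding u_def using less.prems eS by (intro subspace_diff subspace_scale) auto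
    have ue: "e \<bullet> u = 0" by (simp add: u_def inner_diff_right ee m_def)
    have fe: "f e = u + m *\<^sub>R e" by (simp add: u_def)
    \<comment> \<open>The quadratic form \<open>m |y|\<^sup>2 - y \<bullet> f y\<close> is nonnegative on \<open>S\<close> and vanishes at \<open>e\<close>, so its
      derivative at \<open>e\<close> in the direction \<open>u\<close> vanishes too.\<close>
    have var: "2 * t * (u \<bullet> u) \<le> t\<^sup>2 * (m * (u \<bullet> u) - u \<bullet> f u)" for t
    proof -
      have "e + t *\<^sub>R u \<in> S" using eS uS less.prems(1) by (simp add: subspace_add subspace_scale)
      from q[OF this]
      have "(e + t *\<^sub>R u) \<bullet> (f e + t *\<^sub>R f u) \<le> m * ((e + t *\<^sub>R u) \<bullet> (e + t *\<^sub>R u))"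
        by (simp add: add scaleR)
      moreover have "e \<bullet> f u = u \<bullet> u"
        using adj[of e u] fe ue by (simp add: inner_add_left)
      ultimately show ?thesis
        using ue by (simp add: fe inner_add_left inner_add_right ee inner_commute[of u e]
            power2_eq_square algebra_simps)
    qed
    have "u = 0"
    proof (rule ccontr)
      assume "u \<noteq> 0"
      then have p: "u \<bullet> u > 0" by simp
      let ?q = "m * (u \<bullet> u) - u \<bullet> f u"
      have "2 * (u \<bullet> u) \<le> ?q" using var[of 1] by simp
      with p have "?q > 0" by linarith
      with var[of "(u \<bullet> u) / ?q"] have "(u \<bullet> u) * (u \<bullet> u) \<le> 0"
        by (simp add: power2_eq_square divide_simps mult.commute)
      then show False using mult_pos_pos[OF p p] by linarith
    qed
    then have fe: "f e = m *\<^sub>R e" using fe by simp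
    let ?S = "{x \<in> S. e \<bullet> x = 0}"
    have sub: "subspace ?S"
      using less.prems(1) by (auto simp: subspace_def inner_add_right)
    have "dim ?S < dim S"
    proof (rule dim_psubset)
      have "e \<notin> ?S" using ee by simp
      then show "span ?S \<subset> span S"
        using eS unfolding span_eq_iff[THEN iffD2, OF sub] span_eq_iff[THEN iffD2, OF less.prems(1)]
        by blast
    qed
    moreover have "f x \<in> ?S" if "x \<in> ?S" for x
      using that less.prems(2) adj[of e x] fe by simp
    ultimately obtain B where B: "finite B" "B \<subseteq> ?S" "pairwise orthogonal B" "span B = ?S"
      "\<forall>e\<in>B. norm e = 1 \<and> f e = (e \<bullet> f e) *\<^sub>R e"
      using less.hyps[OF _ sub] by blast
    have "S \<subseteq> span (insert e B)"
    proof
      fix x assume "x \<in> S"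
      then have "x - (e \<bullet> x) *\<^sub>R e \<in> span B"
        unfolding B(4) using eS less.prems(1)
        by (auto simp: subspace_diff subspace_scale inner_diff_right ee)
      then show "x \<in> span (insert e B)" by (auto simp: span_insert)
    qed
    moreover have "span (insert e B) \<subseteq> S"
      using eS B(2) less.prems(1) by (intro span_minimal) auto
    ultimately have "span (insert e B) = S" by blast
    moreover have "pairwise orthogonal (insert e B)"
      using B(2,3) by (auto simp: pairwise_insert orthogonal_def inner_commute)
    ultimately show ?thesis
      using B eS ne fe m_def by (intro exI[of _ "insert e B"]) auto
  qed
qed

lemma trace_orthonormal_basis:
  fixes A :: "real^'n^'n"
  assumes B: "finite B" "pairwise orthogonal B" "\<And>e. e \<in> B \<Longrightarrow> norm e = 1" "span B = UNIV"
  shows "trace A = (\<Sum>e\<in>B. e \<bullet> (A *v e))"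
proof -
  have "A $ i $ i = (\<Sum>e\<in>B. e $ i * (A *v e) $ i)" for i
  proof -
    have "(\<Sum>e\<in>B. (axis i 1 \<bullet> e) *\<^sub>R e) = axis i 1"
      using B by (intro orthonormal_basis_expand) auto
    then have *: "axis i 1 = (\<Sum>e\<in>B. e $ i *\<^sub>R e)"
      by (simp add: inner_axis')
    have "A *v axis i 1 = (\<Sum>e\<in>B. e $ i *\<^sub>R (A *v e))"
      by (subst *) (simp add: linear_sum[OF matrix_vector_mul_linear] matrix_vector_mult_scaleR)
    moreover have "A $ i $ i = (A *v axis i 1) $ i"
      by (simp add: matrix_vector_mult_basis column_def)
    ultimately show ?thesis by simp
  qed
  then have "trace A = (\<Sum>i\<in>UNIV. \<Sum>e\<in>B. e $ i * (A *v e) $ i)"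
    by (simp add: trace_def)
  also have "\<dots> = (\<Sum>e\<in>B. e \<bullet> (A *v e))"
    by (subst sum.swap) (simp add: inner_vec_def)
  finally show ?thesis .
qed

lemma symmetric_matrix_orthonormal_eigenbasis:
  fixes A :: "real^'n^'n"
  assumes "transpose A = A"
  obtains B where "finite B" "pairwise orthogonal B" "\<And>e. e \<in> B \<Longrightarrow> norm e = 1" "span B = UNIV"
    "\<And>e. e \<in> B \<Longrightarrow> A *v e = (e \<bullet> (A *v e)) *\<^sub>R e"
proof -
  have "(A *v x) \<bullet> y = x \<bullet> (A *v y)" for x y
    using assms dot_lmul_matrix[of x A y] by (metis transpose_matrix_vector)
  then show thesis
    using self_adjoint_orthonormal_eigenbasis[of "(*v) A" UNIV] that by auto
qed

section \<open>Exponential moments of quadratic forms of a sub-Gaussian vector\<close>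

text \<open>
  Completing the square: up to a constant factor, the integrand is the density of the normal
  distribution with mean \<open>a / (1 - q)\<close> and variance \<open>1 / (1 - q)\<close>.
\<close>
lemma nn_integral_std_normal_exp_quadratic:
  fixes a q :: real
  assumes q: "q < 1"
  shows "(\<integral>\<^sup>+x. ennreal (std_normal_density x * exp (a * x + q / 2 * x\<^sup>2)) \<partial>lborel)
       = ennreal (exp (a\<^sup>2 / (2 * (1 - q))) / sqrt (1 - q))"
proof -
  let ?s = "1 / sqrt (1 - q)" and ?m = "a / (1 - q)"
  let ?C = "exp (a\<^sup>2 / (2 * (1 - q))) / sqrt (1 - q)"
  have s2: "?s\<^sup>2 = 1 / (1 - q)" using q by (simp add: power_divide)
  have eq: "std_normal_density x * exp (a * x + q / 2 * x\<^sup>2) = ?C * normal_density ?m ?s x" for x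
  proof -
    define p where "p = 1 - q"
    have p: "p > 0" "q = 1 - p" using q by (auto simp: p_def)
    have "- x\<^sup>2 / 2 + (a * x + q / 2 * x\<^sup>2)
        = a\<^sup>2 / (2 * (1 - q)) + - (x - ?m)\<^sup>2 / (2 * ?s\<^sup>2)"
      using p(1) unfolding s2 p(2) by (simp add: field_simps power2_eq_square)
    then have "exp (- x\<^sup>2 / 2) * exp (a * x + q / 2 * x\<^sup>2)
        = exp (a\<^sup>2 / (2 * (1 - q))) * exp (- (x - ?m)\<^sup>2 / (2 * ?s\<^sup>2))"
      by (simp only: exp_add[symmetric])
    moreover have "1 / sqrt (2 * pi) = 1 / sqrt (1 - q) * (1 / sqrt (2 * pi * ?s\<^sup>2))"
      using q unfolding s2 by (simp add: real_sqrt_divide real_sqrt_mult)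
    ultimately show ?thesis
      unfolding std_normal_density_def normal_density_def by (simp only: mult_ac times_divide_eq_right)
        (simp add: mult_ac)
  qed
  have one: "(\<integral>\<^sup>+x. ennreal (normal_density ?m ?s x) \<partial>lborel) = 1"
    using q by (subst nn_integral_eq_integral) auto
  have split: "ennreal (?C * normal_density ?m ?s x) = ennreal ?C * ennreal (normal_density ?m ?s x)" for x
    using q by (intro ennreal_mult') auto
  show ?thesis
    unfolding eq split by (subst nn_integral_cmult) (measurable, simp only: one mult_1_right)
qed

text \<open>
  Among all vectors with a given sub-Gaussian parameter, the Gaussian one is the worst case for
  exponentials of positive quadratic forms. The square in the exponent is linearised by one
  auxiliary standard normal variable \<open>x\<close> per direction \<open>j\<close>, through
  \<open>exp (q (j \<bullet> W)\<^sup>2 / 2) = E exp (sqrt q x (j \<bullet> W))\<close>. After exchanging the integrals, only exponential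
  moments of linear forms of \<open>W\<close> remain. The linear form \<open>v\<close> is arbitrary in the induction because
  each linearisation shifts it by a multiple of \<open>j\<close>; this does not affect the other directions,
  which are orthogonal to \<open>j\<close>.
\<close>
lemma subgaussian_exp_quadratic:
  fixes W :: "'a \<Rightarrow> 'b::euclidean_space" and s :: real and q :: "'b \<Rightarrow> real"
  assumes M: "sigma_finite_measure M" and W [measurable]: "W \<in> borel_measurable M"
    and sub: "\<And>v. (\<integral>\<^sup>+\<omega>. ennreal (exp (v \<bullet> W \<omega>)) \<partial>M) \<le> ennreal (exp (s / 2 * (norm v)\<^sup>2))"
    and B: "finite B" "pairwise orthogonal B" "\<And>e. e \<in> B \<Longrightarrow> norm e = 1"
    and q: "\<And>e. e \<in> B \<Longrightarrow> 0 \<le> q e" "\<And>e. e \<in> B \<Longrightarrow> s * q e < 1"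
  shows "(\<integral>\<^sup>+\<omega>. ennreal (exp (v \<bullet> W \<omega> + (\<Sum>e\<in>B. q e * (e \<bullet> W \<omega>)\<^sup>2) / 2)) \<partial>M)
     \<le> ennreal ((\<Prod>e\<in>B. 1 / sqrt (1 - s * q e)) *
          exp (s / 2 * ((norm v)\<^sup>2 + (\<Sum>e\<in>B. s * q e / (1 - s * q e) * (v \<bullet> e)\<^sup>2))))"
  using B q
proof (induction B arbitrary: v rule: finite_induct)
  case empty
  then show ?case using sub[of v] by simp
next
  case (insert j F)
  interpret M: sigma_finite_measure M by (rule M)
  interpret P: pair_sigma_finite M lborel ..
  let ?Q = "\<lambda>\<omega>. (\<Sum>e\<in>F. q e * (e \<bullet> W \<omega>)\<^sup>2) / 2"
  let ?P = "\<Prod>e\<in>F. 1 / sqrt (1 - s * q e)"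
  let ?R = "\<lambda>v. \<Sum>e\<in>F. s * q e / (1 - s * q e) * (v \<bullet> e)\<^sup>2"
  let ?r = "sqrt (q j)"
  have qj: "0 \<le> q j" "s * q j < 1" and nj: "norm j = 1" using insert.prems by auto
  have r2: "?r\<^sup>2 = q j" using qj by simp
  have P: "?P \<ge> 0" using insert.prems by (intro prod_nonneg) (auto simp: less_imp_le)
  have ortho: "j \<bullet> e = 0" if "e \<in> F" for e
    using insert.prems(1) insert.hyps(2) that
    by (metis insertCI orthogonal_def pairwiseD)
  have IH: "(\<integral>\<^sup>+\<omega>. ennreal (exp (v \<bullet> W \<omega> + ?Q \<omega>)) \<partial>M)
      \<le> ennreal (?P * exp (s / 2 * ((norm v)\<^sup>2 + ?R v)))" for v
    using insert.prems by (intro insert.IH) (auto simp: pairwise_insert)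
  have lin: "ennreal (exp (v \<bullet> W \<omega> + (\<Sum>e\<in>insert j F. q e * (e \<bullet> W \<omega>)\<^sup>2) / 2))
     = (\<integral>\<^sup>+x. ennreal (std_normal_density x * exp ((v + (?r * x) *\<^sub>R j) \<bullet> W \<omega> + ?Q \<omega>)) \<partial>lborel)"
    for \<omega>
  proof -
    have "(\<integral>\<^sup>+x. ennreal (std_normal_density x * exp ((v + (?r * x) *\<^sub>R j) \<bullet> W \<omega> + ?Q \<omega>)) \<partial>lborel)
      = (\<integral>\<^sup>+x. ennreal (exp (v \<bullet> W \<omega> + ?Q \<omega>)) *
            ennreal (std_normal_density x * exp (?r * (j \<bullet> W \<omega>) * x + 0 / 2 * x\<^sup>2)) \<partial>lborel)"
      by (intro nn_integral_cong)
        (simp add: ennreal_mult'[symmetric] exp_add inner_add_left mult_ac)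
    also have "\<dots> = ennreal (exp (v \<bullet> W \<omega> + ?Q \<omega>)) * ennreal (exp ((?r * (j \<bullet> W \<omega>))\<^sup>2 / 2))"
      using nn_integral_std_normal_exp_quadratic[of 0 "?r * (j \<bullet> W \<omega>)"]
      by (subst nn_integral_cmult) auto
    also have "\<dots> = ennreal (exp (v \<bullet> W \<omega> + (\<Sum>e\<in>insert j F. q e * (e \<bullet> W \<omega>)\<^sup>2) / 2))"
      using insert.hyps by (simp add: ennreal_mult'[symmetric] exp_add[symmetric]
          power_mult_distrib r2 add_divide_distrib add_ac)
    finally show ?thesis by simp
  qed
  have "(\<integral>\<^sup>+\<omega>. ennreal (exp (v \<bullet> W \<omega> + (\<Sum>e\<in>insert j F. q e * (e \<bullet> W \<omega>)\<^sup>2) / 2)) \<partial>M)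
     = (\<integral>\<^sup>+x. (\<integral>\<^sup>+\<omega>. ennreal (std_normal_density x *
           exp ((v + (?r * x) *\<^sub>R j) \<bullet> W \<omega> + ?Q \<omega>)) \<partial>M) \<partial>lborel)"
    unfolding lin by (rule P.Fubini'[symmetric]) measurable
  also have "\<dots> = (\<integral>\<^sup>+x. ennreal (std_normal_density x) *
         (\<integral>\<^sup>+\<omega>. ennreal (exp ((v + (?r * x) *\<^sub>R j) \<bullet> W \<omega> + ?Q \<omega>)) \<partial>M) \<partial>lborel)"
    by (intro nn_integral_cong) (simp add: ennreal_mult' nn_integral_cmult)
  also have "\<dots> \<le> (\<integral>\<^sup>+x. ennreal (std_normal_density x) *
         ennreal (?P * exp (s / 2 * ((norm (v + (?r * x) *\<^sub>R j))\<^sup>2 + ?R (v + (?r * x) *\<^sub>R j)))) \<partial>lborel)"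
    by (intro nn_integral_mono mult_left_mono IH) auto
  also have "\<dots> = (\<integral>\<^sup>+x. ennreal (?P * exp (s / 2 * ((norm v)\<^sup>2 + ?R v))) *
      ennreal (std_normal_density x * exp ((s * ?r * (v \<bullet> j)) * x + (s * q j) / 2 * x\<^sup>2)) \<partial>lborel)"
  proof (intro nn_integral_cong)
    fix x
    have "?R (v + (?r * x) *\<^sub>R j) = ?R v"
      by (intro sum.cong) (auto simp: inner_add_left ortho)
    moreover have "(norm (v + (?r * x) *\<^sub>R j))\<^sup>2 = (norm v)\<^sup>2 + 2 * (?r * x) * (v \<bullet> j) + q j * x\<^sup>2"
    proof -
      have "(norm (v + c *\<^sub>R j))\<^sup>2 = (norm v)\<^sup>2 + 2 * c * (v \<bullet> j) + c\<^sup>2 * (norm j)\<^sup>2" for c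
        unfolding power2_norm_eq_inner
        by (simp add: inner_add_left inner_add_right inner_commute[of j v] power2_eq_square algebra_simps)
      from this[of "?r * x"] show ?thesis by (simp add: nj power_mult_distrib r2)
    qed
    ultimately have "s / 2 * ((norm (v + (?r * x) *\<^sub>R j))\<^sup>2 + ?R (v + (?r * x) *\<^sub>R j))
       = s / 2 * ((norm v)\<^sup>2 + ?R v) + ((s * ?r * (v \<bullet> j)) * x + (s * q j) / 2 * x\<^sup>2)"
      by (simp add: field_simps)
    then have split: "exp (s / 2 * ((norm (v + (?r * x) *\<^sub>R j))\<^sup>2 + ?R (v + (?r * x) *\<^sub>R j)))
       = exp (s / 2 * ((norm v)\<^sup>2 + ?R v)) * exp ((s * ?r * (v \<bullet> j)) * x + (s * q j) / 2 * x\<^sup>2)"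
      by (simp only: exp_add)
    have comm: "ennreal N * ennreal (?P * (E * E')) = ennreal (?P * E) * ennreal (N * E')"
      if "0 \<le> N" "0 \<le> E" "0 \<le> E'" for N E E' :: real
      using that P by (simp add: ennreal_mult'[symmetric] mult_ac)
    show "ennreal (std_normal_density x) *
         ennreal (?P * exp (s / 2 * ((norm (v + (?r * x) *\<^sub>R j))\<^sup>2 + ?R (v + (?r * x) *\<^sub>R j))))
       = ennreal (?P * exp (s / 2 * ((norm v)\<^sup>2 + ?R v))) *
      ennreal (std_normal_density x * exp ((s * ?r * (v \<bullet> j)) * x + (s * q j) / 2 * x\<^sup>2))"
      unfolding split by (intro comm) auto
  qed
  also have "\<dots> = ennreal (?P * exp (s / 2 * ((norm v)\<^sup>2 + ?R v))) *
      ennreal (exp ((s * ?r * (v \<bullet> j))\<^sup>2 / (2 * (1 - s * q j))) / sqrt (1 - s * q j))"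
    by (subst nn_integral_cmult)
      (measurable, simp only: nn_integral_std_normal_exp_quadratic[OF qj(2)])
  also have "\<dots> = ennreal ((\<Prod>e\<in>insert j F. 1 / sqrt (1 - s * q e)) *
          exp (s / 2 * ((norm v)\<^sup>2 + (\<Sum>e\<in>insert j F. s * q e / (1 - s * q e) * (v \<bullet> e)\<^sup>2))))"
  proof -
    let ?J = "s / 2 * (s * q j / (1 - s * q j) * (v \<bullet> j)\<^sup>2)"
    have J: "(s * ?r * (v \<bullet> j))\<^sup>2 / (2 * (1 - s * q j)) = ?J"
      using qj(1) by (simp add: power_mult_distrib r2 power2_eq_square)
    have "s / 2 * ((norm v)\<^sup>2 + (\<Sum>e\<in>insert j F. s * q e / (1 - s * q e) * (v \<bullet> e)\<^sup>2))
        = s / 2 * ((norm v)\<^sup>2 + ?R v) + ?J"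
      by (simp only: sum.insert[OF insert.hyps] distrib_left add_ac)
    moreover have "ennreal (?P * E) * ennreal (E' / sqrt (1 - s * q j))
        = ennreal (1 / sqrt (1 - s * q j) * ?P * (E * E'))" if "0 \<le> E" "0 \<le> E'" for E E' :: real
      using that P qj(2) by (simp add: ennreal_mult'[symmetric] mult_ac)
    ultimately show ?thesis
      by (simp only: J exp_add prod.insert[OF insert.hyps] exp_ge_zero)
  qed
  finally show ?case .
qed

text \<open>For \<open>y = 1 / (1 - u)\<close> this is \<open>ln y \<le> (y - 1 / y) / 2\<close>, that is, \<open>x \<le> sinh x\<close> at \<open>x = ln y\<close>.\<close>
lemma minus_ln_one_minus_le:
  fixes u :: real
  assumes "0 \<le> u" "u < 1"
  shows "- ln (1 - u) \<le> u + u\<^sup>2 / (2 * (1 - u))"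
proof -
  define y where "y = inverse (1 - u)"
  have y: "y \<ge> 1" using assms by (simp add: y_def one_le_inverse_iff)
  have "ln y \<le> sinh (ln y)"
    using real_le_x_sinh[of "ln y"] y by (simp add: sinh_field_def exp_minus)
  also have "\<dots> = (y - inverse y) / 2" using y by (simp add: sinh_ln_real)
  also have "\<dots> = u + u\<^sup>2 / (2 * (1 - u))"
    using assms by (simp add: y_def field_simps power2_eq_square)
  finally show ?thesis by (simp add: y_def ln_inverse)
qed

text \<open>
  In an eigenbasis of \<open>A\<close> the bound of \<open>subgaussian_exp_quadratic\<close> contains the factor
  \<open>det (I - 4 \<sigma>\<^sup>2 A / \<beta>)\<close> to the power \<open>- 1 / 2\<close>. Since \<open>- ln (1 - u) \<le> u + u\<^sup>2 / (2 (1 - u))\<close> for each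
  eigenvalue \<open>u \<le> 4 \<sigma>\<^sup>2 / \<beta>\<close> of \<open>4 \<sigma>\<^sup>2 A / \<beta>\<close>, this factor is controlled by the traces of \<open>A\<close> and \<open>A\<^sup>2\<close>. The first trace is the correction term of
  the unbiased risk estimate, the second one is the lower bound imposed on the penalty.
\<close>
lemma subgaussian_exp_psd_quadratic_form:
  fixes W :: "'a \<Rightarrow> real^'n" and A :: "real^'n^'n" and \<sigma> \<beta> :: real
  assumes M: "sigma_finite_measure M" and W: "W \<in> borel_measurable M"
    and sub: "\<And>v. (\<integral>\<^sup>+\<omega>. ennreal (exp (v \<bullet> W \<omega>)) \<partial>M) \<le> ennreal (exp (\<sigma>\<^sup>2 / 2 * (norm v)\<^sup>2))"
    and A: "pos_semidef A" "\<And>x. x \<bullet> (A *v x) \<le> x \<bullet> x"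
    and \<beta>: "\<beta> > 4 * \<sigma>\<^sup>2"
  shows "(\<integral>\<^sup>+\<omega>. ennreal (exp (v \<bullet> W \<omega> + 2 * (W \<omega> \<bullet> (A *v W \<omega>)) / \<beta>)) \<partial>M)
     \<le> ennreal (exp ((2 * \<sigma>\<^sup>2 * trace A + 4 * \<sigma>\<^sup>2 / (\<beta> - 4 * \<sigma>\<^sup>2) * \<sigma>\<^sup>2 * trace (A ** A)) / \<beta>
           + \<sigma>\<^sup>2 * \<beta> / (2 * (\<beta> - 4 * \<sigma>\<^sup>2)) * (norm v)\<^sup>2))"
proof -
  have tA: "transpose A = A" and psd: "\<And>x. 0 \<le> x \<bullet> (A *v x)"
    using A(1) by (auto simp: pos_semidef_def)
  obtain B where B: "finite B" "pairwise orthogonal B" "\<And>e. e \<in> B \<Longrightarrow> norm e = 1" "span B = UNIV"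
    and eig: "\<And>e. e \<in> B \<Longrightarrow> A *v e = (e \<bullet> (A *v e)) *\<^sub>R e"
    using symmetric_matrix_orthonormal_eigenbasis[OF tA] by blast
  define l where "l e = e \<bullet> (A *v e)" for e
  have eig: "A *v e = l e *\<^sub>R e" if "e \<in> B" for e using eig[OF that] by (simp add: l_def)
  have l0: "0 \<le> l e" for e using psd by (simp add: l_def)
  have l1: "l e \<le> 1" if "e \<in> B" for e
    using A(2)[of e] B(3)[OF that] by (simp add: l_def dot_square_norm)
  have \<beta>0: "\<beta> > 0" using \<beta> zero_le_power2[of \<sigma>] by linarith
  define q where "q e = 4 * l e / \<beta>" for e
  define u where "u e = \<sigma>\<^sup>2 * q e" for e
  have q0: "0 \<le> q e" for e using l0 \<beta>0 by (simp add: q_def)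
  have u0: "0 \<le> u e" for e using q0 by (simp add: u_def)
  have ul: "u e \<le> 4 * \<sigma>\<^sup>2 / \<beta>" if "e \<in> B" for e
    using mult_left_mono[OF l1[OF that], of "4 * \<sigma>\<^sup>2 / \<beta>"] \<beta>0
    by (simp add: u_def q_def mult_ac)
  have b1: "4 * \<sigma>\<^sup>2 / \<beta> < 1" using \<beta> \<beta>0 by simp
  have u1: "u e < 1" if "e \<in> B" for e using ul[OF that] b1 by simp
  have expand: "(\<Sum>e\<in>B. (x \<bullet> e) *\<^sub>R e) = x" for x
    using B by (intro orthonormal_basis_expand) auto
  have parseval: "x \<bullet> y = (\<Sum>e\<in>B. (x \<bullet> e) * (e \<bullet> y))" for x y
    by (subst (1) expand[of x, symmetric]) (simp add: inner_sum_left)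
  have sym: "(A *v x) \<bullet> y = x \<bullet> (A *v y)" for x y
    using tA dot_lmul_matrix[of x A y] by (metis transpose_matrix_vector)
  have form: "x \<bullet> (A *v x) = (\<Sum>e\<in>B. l e * (e \<bullet> x)\<^sup>2)" for x
    unfolding parseval[of x "A *v x"]
    by (intro sum.cong)
      (auto simp: sym[symmetric] eig power2_eq_square inner_commute)
  have "trace (A ** A) = (\<Sum>e\<in>B. e \<bullet> (A *v (A *v e)))"
    by (simp add: trace_orthonormal_basis[OF B] matrix_vector_mul_assoc)
  also have "\<dots> = (\<Sum>e\<in>B. (l e)\<^sup>2)"
    using B(3) by (intro sum.cong) (auto simp: eig matrix_vector_mult_scaleR dot_square_norm power2_eq_square)
  finally have tr2: "trace (A ** A) = (\<Sum>e\<in>B. (l e)\<^sup>2)" .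
  have tr1: "trace A = (\<Sum>e\<in>B. l e)" by (simp add: trace_orthonormal_basis[OF B] l_def)

  have det: "1 / sqrt (1 - u e) \<le>
      exp ((2 * \<sigma>\<^sup>2 * l e + 4 * \<sigma>\<^sup>2 / (\<beta> - 4 * \<sigma>\<^sup>2) * \<sigma>\<^sup>2 * (l e)\<^sup>2) / \<beta>)" if "e \<in> B" for e
  proof -
    have "1 / sqrt (1 - u e) = exp (- ln (sqrt (1 - u e)))"
      using u1[OF that] by (simp add: exp_minus inverse_eq_divide)
    also have "\<dots> = exp (- ln (1 - u e) / 2)"
      using u1[OF that] by (simp add: ln_sqrt)
    also have "\<dots> \<le> exp (u e / 2 + (u e)\<^sup>2 / (4 * (1 - u e)))"
    proof -
      have "- ln (1 - u e) / 2 \<le> (u e + (u e)\<^sup>2 / (2 * (1 - u e))) / 2"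
        using minus_ln_one_minus_le[OF u0 u1[OF that]] by (intro divide_right_mono) auto
      also have "\<dots> = u e / 2 + (u e)\<^sup>2 / (4 * (1 - u e))"
        by (simp add: add_divide_distrib)
      finally show ?thesis unfolding exp_le_cancel_iff .
    qed
    also have "(u e)\<^sup>2 / (4 * (1 - u e)) \<le> (u e)\<^sup>2 / (4 * (1 - 4 * \<sigma>\<^sup>2 / \<beta>))"
      using ul[OF that] b1 u1[OF that] by (intro divide_left_mono mult_pos_pos) auto
    also have "u e / 2 + (u e)\<^sup>2 / (4 * (1 - 4 * \<sigma>\<^sup>2 / \<beta>))
       = (2 * \<sigma>\<^sup>2 * l e + 4 * \<sigma>\<^sup>2 / (\<beta> - 4 * \<sigma>\<^sup>2) * \<sigma>\<^sup>2 * (l e)\<^sup>2) / \<beta>"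
      using \<beta> \<beta>0 by (simp add: u_def q_def divide_simps)
        (simp add: power2_eq_square power4_eq_xxxx algebra_simps)
    finally show ?thesis by simp
  qed
  have prod: "(\<Prod>e\<in>B. 1 / sqrt (1 - u e)) \<le>
     exp ((2 * \<sigma>\<^sup>2 * trace A + 4 * \<sigma>\<^sup>2 / (\<beta> - 4 * \<sigma>\<^sup>2) * \<sigma>\<^sup>2 * trace (A ** A)) / \<beta>)"
  proof -
    have "(\<Prod>e\<in>B. 1 / sqrt (1 - u e)) \<le>
       (\<Prod>e\<in>B. exp ((2 * \<sigma>\<^sup>2 * l e + 4 * \<sigma>\<^sup>2 / (\<beta> - 4 * \<sigma>\<^sup>2) * \<sigma>\<^sup>2 * (l e)\<^sup>2) / \<beta>))"
      using det u1 by (intro prod_mono) (auto simp: less_imp_le)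
    also have "\<dots> = exp ((2 * \<sigma>\<^sup>2 * trace A + 4 * \<sigma>\<^sup>2 / (\<beta> - 4 * \<sigma>\<^sup>2) * \<sigma>\<^sup>2 * trace (A ** A)) / \<beta>)"
      using B(1) by (simp add: exp_sum[symmetric] tr1 tr2 sum_divide_distrib sum.distrib sum_distrib_left
          add_divide_distrib)
    finally show ?thesis .
  qed
  \<comment> \<open>By Parseval's identity, replacing every \<open>u e\<close> by its upper bound leaves a multiple of
    \<open>(norm v)\<^sup>2\<close>.\<close>
  have lin: "(norm v)\<^sup>2 + (\<Sum>e\<in>B. u e / (1 - u e) * (v \<bullet> e)\<^sup>2) \<le> \<beta> / (\<beta> - 4 * \<sigma>\<^sup>2) * (norm v)\<^sup>2"
  proof -
    have "(\<Sum>e\<in>B. u e / (1 - u e) * (v \<bullet> e)\<^sup>2)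
        \<le> (\<Sum>e\<in>B. (4 * \<sigma>\<^sup>2 / \<beta>) / (1 - 4 * \<sigma>\<^sup>2 / \<beta>) * (v \<bullet> e)\<^sup>2)"
      using ul u0 b1 \<beta>0 by (intro sum_mono mult_right_mono frac_le) auto
    also have "\<dots> = (4 * \<sigma>\<^sup>2 / \<beta>) / (1 - 4 * \<sigma>\<^sup>2 / \<beta>) * (norm v)\<^sup>2"
      unfolding power2_norm_eq_inner[of v]
      by (subst parseval) (simp add: sum_distrib_left inner_commute power2_eq_square)
    also have "\<dots> = \<beta> / (\<beta> - 4 * \<sigma>\<^sup>2) * (norm v)\<^sup>2 - (norm v)\<^sup>2"
      using \<beta> \<beta>0 by (simp add: divide_simps) (simp add: algebra_simps)
    finally show ?thesis by simp
  qed
  then have lin': "\<sigma>\<^sup>2 / 2 * ((norm v)\<^sup>2 + (\<Sum>e\<in>B. u e / (1 - u e) * (v \<bullet> e)\<^sup>2))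
      \<le> \<sigma>\<^sup>2 / 2 * (\<beta> / (\<beta> - 4 * \<sigma>\<^sup>2) * (norm v)\<^sup>2)"
    by (intro mult_left_mono) auto
  have "(\<integral>\<^sup>+\<omega>. ennreal (exp (v \<bullet> W \<omega> + 2 * (W \<omega> \<bullet> (A *v W \<omega>)) / \<beta>)) \<partial>M)
      = (\<integral>\<^sup>+\<omega>. ennreal (exp (v \<bullet> W \<omega> + (\<Sum>e\<in>B. q e * (e \<bullet> W \<omega>)\<^sup>2) / 2)) \<partial>M)"
    by (simp add: form q_def sum_divide_distrib sum_distrib_left)
  also have "\<dots> \<le> ennreal ((\<Prod>e\<in>B. 1 / sqrt (1 - u e)) *
          exp (\<sigma>\<^sup>2 / 2 * ((norm v)\<^sup>2 + (\<Sum>e\<in>B. u e / (1 - u e) * (v \<bullet> e)\<^sup>2))))"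
    unfolding u_def using u1 by (intro subgaussian_exp_quadratic[OF M W sub B(1-3) q0]) (auto simp: u_def)
  also have "\<dots> \<le> ennreal (exp ((2 * \<sigma>\<^sup>2 * trace A + 4 * \<sigma>\<^sup>2 / (\<beta> - 4 * \<sigma>\<^sup>2) * \<sigma>\<^sup>2 * trace (A ** A)) / \<beta>) *
          exp (\<sigma>\<^sup>2 / 2 * (\<beta> / (\<beta> - 4 * \<sigma>\<^sup>2) * (norm v)\<^sup>2)))"
    using lin' by (intro ennreal_leI mult_mono prod) (simp_all only: exp_le_cancel_iff exp_ge_zero)
  finally show ?thesis by (simp add: exp_add mult_ac)
qed

text \<open>
  The constant \<open>\<gamma>\<close> is the smaller root of \<open>\<gamma> (\<beta> - 4 \<sigma>\<^sup>2) = 2 \<sigma>\<^sup>2 (1 + 2 \<gamma>)\<^sup>2\<close>. The product of the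
  two roots is \<open>1 / 4\<close>, and they are distinct for \<open>\<beta> > 20 \<sigma>\<^sup>2\<close>, so the smaller one lies below
  \<open>1 / 2\<close>.
\<close>
lemma smaller_root_temperature_equation:
  fixes \<sigma> \<beta> \<gamma> :: real
  assumes s: "\<sigma> > 0" and \<beta>: "\<beta> > 20 * \<sigma>\<^sup>2"
    and \<gamma>: "\<gamma> = (\<beta> - 12 * \<sigma>\<^sup>2 - sqrt (\<beta> - 4 * \<sigma>\<^sup>2) * sqrt (\<beta> - 20 * \<sigma>\<^sup>2)) / (16 * \<sigma>\<^sup>2)"
  shows "\<gamma> * (\<beta> - 4 * \<sigma>\<^sup>2) = 2 * \<sigma>\<^sup>2 * (1 + 2 * \<gamma>)\<^sup>2" "0 < \<gamma>" "2 * \<gamma> < 1"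
proof -
  define a where "a = sqrt (\<beta> - 4 * \<sigma>\<^sup>2)"
  define d where "d = sqrt (\<beta> - 20 * \<sigma>\<^sup>2)"
  have s2: "\<sigma>\<^sup>2 > 0" using s by simp
  have \<beta>4: "\<beta> > 4 * \<sigma>\<^sup>2" using \<beta> s2 by linarith
  have a: "a\<^sup>2 = \<beta> - 4 * \<sigma>\<^sup>2" "a > 0" and d: "d\<^sup>2 = \<beta> - 20 * \<sigma>\<^sup>2" "d > 0"
    using \<beta> s2 \<beta>4 by (auto simp: a_def d_def)
  have ad: "d < a" using s2 by (auto simp: a_def d_def)
  have ss: "16 * \<sigma>\<^sup>2 = a\<^sup>2 - d\<^sup>2" using a d by simp
  \<comment> \<open>With \<open>a\<^sup>2 - d\<^sup>2 = 16 \<sigma>\<^sup>2\<close> and \<open>(a\<^sup>2 + d\<^sup>2) / 2 = \<beta> - 12 \<sigma>\<^sup>2\<close>, \<open>\<gamma>\<close> becomes a simple quotient.\<close>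
  have "\<beta> - 12 * \<sigma>\<^sup>2 - a * d = (a - d)\<^sup>2 / 2" using a d by (simp add: power2_diff)
  moreover have "16 * \<sigma>\<^sup>2 = (a - d) * (a + d)"
    using ss by (simp add: power2_eq_square algebra_simps)
  ultimately have "\<gamma> = ((a - d)\<^sup>2 / 2) / ((a - d) * (a + d))"
    unfolding \<gamma> a_def[symmetric] d_def[symmetric] by (simp only:)
  also have "\<dots> = (a - d) / (2 * (a + d))"
    using ad d by (simp add: power2_eq_square)
  finally have g: "\<gamma> = (a - d) / (2 * (a + d))" .
  show "0 < \<gamma>" "2 * \<gamma> < 1" using ad d by (auto simp: g divide_simps)
  have "1 + 2 * \<gamma> = 2 * a / (a + d)" using ad d by (simp add: g divide_simps)
  moreover have "2 * \<sigma>\<^sup>2 = (a - d) * (a + d) / 8"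
    using ss by (simp add: power2_eq_square algebra_simps)
  moreover have "\<gamma> * (\<beta> - 4 * \<sigma>\<^sup>2) = (a - d) / (2 * (a + d)) * a\<^sup>2" by (simp only: g a(1))
  moreover have "(a - d) / (2 * (a + d)) * a\<^sup>2 = (a - d) * (a + d) / 8 * (2 * a / (a + d))\<^sup>2"
    using ad d by (simp add: divide_simps power2_eq_square)
  ultimately show "\<gamma> * (\<beta> - 4 * \<sigma>\<^sup>2) = 2 * \<sigma>\<^sup>2 * (1 + 2 * \<gamma>)\<^sup>2"
    by (simp only:)
qed

text \<open>
  The difference of two affine estimators is \<open>D W + d\<close> with \<open>D = A - A'\<close>. The part of the exponent
  that is quadratic in \<open>W\<close> is at most the form of \<open>2 A\<close>, because \<open>A'\<close> is positive semi-definite and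
  the term with \<open>\<gamma>\<close> is subtracted. The remaining cross term is the linear form
  \<open>2 (d - \<gamma> D d) \<bullet> W\<close>, and \<open>|d - \<gamma> D d| \<le> (1 + 2 \<gamma>) |d|\<close>; its sub-Gaussian cost is absorbed by
  \<open>- \<gamma> |d|\<^sup>2\<close>, which is what the condition on \<open>\<gamma>\<close> expresses.
\<close>
lemma subgaussian_affine_pair_exp_moment:
  fixes W :: "'a \<Rightarrow> real^'n" and A A' :: "real^'n^'n" and d :: "real^'n" and \<sigma> \<beta> \<gamma> :: real
  assumes M: "sigma_finite_measure M" and W: "W \<in> borel_measurable M"
    and sub: "\<And>v. (\<integral>\<^sup>+\<omega>. ennreal (exp (v \<bullet> W \<omega>)) \<partial>M) \<le> ennreal (exp (\<sigma>\<^sup>2 / 2 * (norm v)\<^sup>2))"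
    and A: "pos_semidef A" "\<And>x. norm (A *v x) \<le> norm x"
    and A': "pos_semidef A'" "\<And>x. norm (A' *v x) \<le> norm x"
    and \<beta>: "\<beta> > 4 * \<sigma>\<^sup>2"
    and \<gamma>: "0 \<le> \<gamma>" "2 * \<sigma>\<^sup>2 * (1 + 2 * \<gamma>)\<^sup>2 \<le> \<gamma> * (\<beta> - 4 * \<sigma>\<^sup>2)"
  shows "(\<integral>\<^sup>+\<omega>. ennreal (exp ((2 * (W \<omega> \<bullet> ((A - A') *v W \<omega> + d))
              - \<gamma> * (norm ((A - A') *v W \<omega> + d))\<^sup>2) / \<beta>)) \<partial>M)
     \<le> ennreal (exp ((2 * \<sigma>\<^sup>2 * trace A + 4 * \<sigma>\<^sup>2 / (\<beta> - 4 * \<sigma>\<^sup>2) * \<sigma>\<^sup>2 * trace (A ** A)) / \<beta>))"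
proof -
  have \<beta>0: "\<beta> > 0" using \<beta> zero_le_power2[of \<sigma>] by linarith
  define D where "D = A - A'"
  define v where "v = (2 / \<beta>) *\<^sub>R (d - \<gamma> *\<^sub>R (D *v d))"
  let ?K = "(2 * \<sigma>\<^sup>2 * trace A + 4 * \<sigma>\<^sup>2 / (\<beta> - 4 * \<sigma>\<^sup>2) * \<sigma>\<^sup>2 * trace (A ** A)) / \<beta>"
  have "transpose D = D"
    using A(1) A'(1) by (simp add: D_def pos_semidef_def transpose_def vec_eq_iff)
  then have sym: "(D *v x) \<bullet> y = x \<bullet> (D *v y)" for x y
    using dot_lmul_matrix[of x D y] by (metis transpose_matrix_vector)
  have Ale: "x \<bullet> (A *v x) \<le> x \<bullet> x" for x
  proof -
    have "x \<bullet> (A *v x) \<le> norm x * norm (A *v x)" by (rule norm_cauchy_schwarz)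
    also have "\<dots> \<le> norm x * norm x" using A(2) by (intro mult_left_mono) auto
    finally show ?thesis by (simp add: dot_square_norm power2_eq_square)
  qed
  have pt: "(2 * (w \<bullet> (D *v w + d)) - \<gamma> * (norm (D *v w + d))\<^sup>2) / \<beta>
      \<le> - (\<gamma> * (norm d)\<^sup>2 / \<beta>) + (v \<bullet> w + 2 * (w \<bullet> (A *v w)) / \<beta>)" for w
  proof -
    have "(norm (D *v w + d))\<^sup>2 = (norm (D *v w))\<^sup>2 + 2 * (w \<bullet> (D *v d)) + (norm d)\<^sup>2"
      by (simp add: power2_norm_eq_inner inner_add_left inner_add_right sym[of w d]
          inner_commute[of d "D *v w"])
    then have 1: "\<gamma> * (2 * (w \<bullet> (D *v d)) + (norm d)\<^sup>2) \<le> \<gamma> * (norm (D *v w + d))\<^sup>2"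
      using \<gamma>(1) by (intro mult_left_mono) auto
    have 2: "w \<bullet> (D *v w) \<le> w \<bullet> (A *v w)"
      using A'(1) by (simp add: D_def pos_semidef_def matrix_vector_mult_diff_rdistrib inner_diff_right)
    have "2 * (w \<bullet> (D *v w + d)) - \<gamma> * (norm (D *v w + d))\<^sup>2
      \<le> 2 * (w \<bullet> (A *v w)) + 2 * (w \<bullet> d) - \<gamma> * (2 * (w \<bullet> (D *v d)) + (norm d)\<^sup>2)"
      using 1 2 by (simp add: inner_add_right)
    also have "\<dots> = \<beta> * (- (\<gamma> * (norm d)\<^sup>2 / \<beta>) + (v \<bullet> w + 2 * (w \<bullet> (A *v w)) / \<beta>))"
      using \<beta>0 by (simp add: v_def inner_commute[of _ w] inner_diff_right field_simps)
    finally show ?thesis using \<beta>0 by (simp add: divide_le_eq mult.commute)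
  qed
  have "norm (D *v d) \<le> norm (A *v d) + norm (A' *v d)"
    by (simp add: D_def matrix_vector_mult_diff_rdistrib norm_triangle_ineq4)
  also have "\<dots> \<le> 2 * norm d" using A(2)[of d] A'(2)[of d] by simp
  finally have Dd: "norm (\<gamma> *\<^sub>R (D *v d)) \<le> \<gamma> * (2 * norm d)"
    using \<gamma>(1) by (simp add: mult_left_mono)
  have "norm (d - \<gamma> *\<^sub>R (D *v d)) \<le> norm d + norm (\<gamma> *\<^sub>R (D *v d))" by (rule norm_triangle_ineq4)
  also have "\<dots> \<le> (1 + 2 * \<gamma>) * norm d" using Dd by (simp add: algebra_simps)
  finally have "norm v \<le> 2 / \<beta> * ((1 + 2 * \<gamma>) * norm d)"
    using \<beta>0 by (simp add: v_def divide_right_mono)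
  then have "(norm v)\<^sup>2 \<le> (2 / \<beta> * ((1 + 2 * \<gamma>) * norm d))\<^sup>2" by (intro power_mono) auto
  then have "\<sigma>\<^sup>2 * \<beta> / (2 * (\<beta> - 4 * \<sigma>\<^sup>2)) * (norm v)\<^sup>2
      \<le> \<sigma>\<^sup>2 * \<beta> / (2 * (\<beta> - 4 * \<sigma>\<^sup>2)) * (2 / \<beta> * ((1 + 2 * \<gamma>) * norm d))\<^sup>2"
    using \<beta> \<beta>0 by (intro mult_left_mono) auto
  also have "\<dots> = 2 * \<sigma>\<^sup>2 * (1 + 2 * \<gamma>)\<^sup>2 * ((norm d)\<^sup>2 / (\<beta> * (\<beta> - 4 * \<sigma>\<^sup>2)))"
    using \<beta> \<beta>0 by (simp add: power_mult_distrib power_divide divide_simps) (simp add: power2_eq_square)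
  also have "\<dots> \<le> \<gamma> * (\<beta> - 4 * \<sigma>\<^sup>2) * ((norm d)\<^sup>2 / (\<beta> * (\<beta> - 4 * \<sigma>\<^sup>2)))"
    using \<beta> \<beta>0 by (intro mult_right_mono \<gamma>(2)) auto
  also have "\<dots> = \<gamma> * (norm d)\<^sup>2 / \<beta>" using \<beta> \<beta>0 by simp
  finally have v: "\<sigma>\<^sup>2 * \<beta> / (2 * (\<beta> - 4 * \<sigma>\<^sup>2)) * (norm v)\<^sup>2 \<le> \<gamma> * (norm d)\<^sup>2 / \<beta>" .
  have [measurable]: "(\<lambda>\<omega>. A *v W \<omega>) \<in> borel_measurable M"
    using W by (intro borel_measurable_continuous_on[OF matrix_vector_mult_linear_continuous_on])
  have [measurable]: "W \<in> borel_measurable M" by (rule W)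
  have "(\<integral>\<^sup>+\<omega>. ennreal (exp ((2 * (W \<omega> \<bullet> (D *v W \<omega> + d)) - \<gamma> * (norm (D *v W \<omega> + d))\<^sup>2) / \<beta>)) \<partial>M)
     \<le> (\<integral>\<^sup>+\<omega>. ennreal (exp (- (\<gamma> * (norm d)\<^sup>2 / \<beta>))) *
            ennreal (exp (v \<bullet> W \<omega> + 2 * (W \<omega> \<bullet> (A *v W \<omega>)) / \<beta>)) \<partial>M)"
    using pt by (intro nn_integral_mono)
      (simp only: ennreal_mult'[symmetric] exp_ge_zero exp_add[symmetric] ennreal_leI exp_le_cancel_iff)
  also have "\<dots> = ennreal (exp (- (\<gamma> * (norm d)\<^sup>2 / \<beta>))) *
      (\<integral>\<^sup>+\<omega>. ennreal (exp (v \<bullet> W \<omega> + 2 * (W \<omega> \<bullet> (A *v W \<omega>)) / \<beta>)) \<partial>M)"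
    by (intro nn_integral_cmult) measurable
  also have "\<dots> \<le> ennreal (exp (- (\<gamma> * (norm d)\<^sup>2 / \<beta>))) *
      ennreal (exp (?K + \<sigma>\<^sup>2 * \<beta> / (2 * (\<beta> - 4 * \<sigma>\<^sup>2)) * (norm v)\<^sup>2))"
    by (intro mult_left_mono subgaussian_exp_psd_quadratic_form[OF M W sub A(1) Ale \<beta>]) auto
  also have "\<dots> = ennreal (exp (- (\<gamma> * (norm d)\<^sup>2 / \<beta>) + (?K + \<sigma>\<^sup>2 * \<beta> / (2 * (\<beta> - 4 * \<sigma>\<^sup>2)) * (norm v)\<^sup>2)))"
    by (simp add: ennreal_mult'[symmetric] exp_add[symmetric])
  also have "\<dots> \<le> ennreal (exp ?K)"
    using v by (intro ennreal_leI) simp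
  finally show ?thesis by (simp add: D_def)
qed

section \<open>Convexity and change of measure\<close>

lemma ennreal_integral_le_nn_integral:
  fixes f :: "'a \<Rightarrow> real"
  assumes "integrable M f"
  shows "ennreal (\<integral>x. f x \<partial>M) \<le> (\<integral>\<^sup>+x. ennreal (f x) \<partial>M)"
proof -
  have "(\<integral>x. f x \<partial>M) \<le> (\<integral>x. max 0 (f x) \<partial>M)"
    using assms by (intro integral_mono) auto
  then have "ennreal (\<integral>x. f x \<partial>M) \<le> ennreal (\<integral>x. max 0 (f x) \<partial>M)"
    by (rule ennreal_leI)
  also have "\<dots> = (\<integral>\<^sup>+x. ennreal (max 0 (f x)) \<partial>M)"
    using assms by (intro nn_integral_eq_integral[symmetric]) auto
  also have "\<dots> = (\<integral>\<^sup>+x. ennreal (f x) \<partial>M)"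
    by (intro nn_integral_cong) (auto simp: max_def ennreal_neg)
  finally show ?thesis .
qed

text \<open>
  Jensen's inequality for the exponential function, from the tangent at the mean. On the right
  the integral is the nonnegative one, which may be infinite.
\<close>
lemma (in prob_space) exp_integral_le_nn_integral_exp:
  fixes f :: "'a \<Rightarrow> real"
  assumes f: "integrable M f"
  shows "ennreal (exp (\<integral>x. f x \<partial>M)) \<le> (\<integral>\<^sup>+x. ennreal (exp (f x)) \<partial>M)"
proof -
  define m where "m = (\<integral>x. f x \<partial>M)"
  have "ennreal (exp m) = ennreal (\<integral>x. exp m * (1 + (f x - m)) \<partial>M)"
    using f by (simp add: m_def prob_space)
  also have "\<dots> \<le> (\<integral>\<^sup>+x. ennreal (exp m * (1 + (f x - m))) \<partial>M)"
    using f by (intro ennreal_integral_le_nn_integral) auto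
  also have "\<dots> \<le> (\<integral>\<^sup>+x. ennreal (exp (f x)) \<partial>M)"
  proof (intro nn_integral_mono ennreal_leI)
    fix x
    have "exp m * (1 + (f x - m)) \<le> exp m * exp (f x - m)"
      by (intro mult_left_mono exp_ge_add_one_self) auto
    then show "exp m * (1 + (f x - m)) \<le> exp (f x)" by (simp add: exp_diff)
  qed
  finally show ?thesis by (simp add: m_def)
qed

text \<open>
  The squared distance is bounded below by its tangent at the mean, an affine function of \<open>f x\<close>
  to which the scalar inequality applies even where the squared distance has infinite mean.
\<close>
lemma (in prob_space) exp_norm_mean_le_nn_integral_exp_norm:
  fixes f :: "'a \<Rightarrow> 'b::euclidean_space"
  assumes f: "integrable M f" and k: "0 \<le> k"
  shows "ennreal (exp (k * (norm (z - (\<integral>x. f x \<partial>M)))\<^sup>2))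
           \<le> (\<integral>\<^sup>+x. ennreal (exp (k * (norm (z - f x))\<^sup>2)) \<partial>M)"
proof -
  define m where "m = (\<integral>x. f x \<partial>M)"
  let ?g = "\<lambda>x. k * (norm (z - m))\<^sup>2 + 2 * k * ((z - m) \<bullet> (m - f x))"
  have g: "integrable M ?g" using f by auto
  have "(\<integral>x. ?g x \<partial>M) = k * (norm (z - m))\<^sup>2"
    using f by (simp add: prob_space m_def)
  then have "ennreal (exp (k * (norm (z - m))\<^sup>2)) \<le> (\<integral>\<^sup>+x. ennreal (exp (?g x)) \<partial>M)"
    using exp_integral_le_nn_integral_exp[OF g] by simp
  also have "\<dots> \<le> (\<integral>\<^sup>+x. ennreal (exp (k * (norm (z - f x))\<^sup>2)) \<partial>M)"
  proof (intro nn_integral_mono ennreal_leI, unfold exp_le_cancel_iff)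
    fix x
    have "(norm (z - f x))\<^sup>2 = (norm ((z - m) + (m - f x)))\<^sup>2" by simp
    also have "\<dots> = (norm (z - m))\<^sup>2 + 2 * ((z - m) \<bullet> (m - f x)) + (norm (m - f x))\<^sup>2"
      unfolding power2_norm_eq_inner inner_add_left inner_add_right
      by (simp add: inner_commute[of "m - f x" "z - m"])
    finally have "(norm (z - m))\<^sup>2 + 2 * ((z - m) \<bullet> (m - f x)) \<le> (norm (z - f x))\<^sup>2" by simp
    from mult_left_mono[OF this k] show "?g x \<le> k * (norm (z - f x))\<^sup>2"
      by (simp add: algebra_simps)
  qed
  finally show ?thesis by (simp add: m_def)
qed

text \<open>
  The easy half of the Donsker--Varadhan formula. On the support of \<open>d\<mu>/d\<pi>\<close>, the integral of
  \<open>exp \<psi>\<close> against \<open>\<pi>\<close> is that of \<open>exp (\<psi> - ln (d\<mu>/d\<pi>))\<close> against \<open>\<mu>\<close>, to which Jensen's inequality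
  applies.
\<close>
lemma donsker_varadhan_le:
  assumes \<pi>: "prob_space \<pi>" and \<mu>: "prob_space \<mu>" "sets \<mu> = sets \<pi>" "absolutely_continuous \<pi> \<mu>"
    and ent: "integrable \<mu> (entropy_density (exp 1) \<pi> \<mu>)"
    and \<psi>: "integrable \<mu> \<psi>"
  shows "ennreal (exp ((\<integral>t. \<psi> t \<partial>\<mu>) - KL_divergence (exp 1) \<pi> \<mu>)) \<le> (\<integral>\<^sup>+t. ennreal (exp (\<psi> t)) \<partial>\<pi>)"
proof -
  interpret \<pi>: prob_space \<pi> by fact
  interpret \<mu>: prob_space \<mu> by fact
  let ?d = "RN_deriv \<pi> \<mu>" and ?L = "entropy_density (exp 1) \<pi> \<mu>"
  have dens: "density \<pi> ?d = \<mu>"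
    using \<mu> by (intro \<pi>.density_RN_deriv) auto
  have [measurable]: "\<psi> \<in> borel_measurable \<pi>"
    using borel_measurable_integrable[OF \<psi>] \<mu>(2) by (simp cong: measurable_cong_sets)
  have [measurable]: "?L \<in> borel_measurable \<pi>" by (auto simp: entropy_density_def)
  have fin: "AE t in \<pi>. ?d t \<noteq> \<infinity>"
    using \<mu> \<mu>.sigma_finite_measure_axioms by (intro \<pi>.RN_deriv_finite) auto
  have "KL_divergence (exp 1) \<pi> \<mu> = (\<integral>t. ?L t \<partial>\<mu>)" by (simp add: KL_divergence_def)
  then have "ennreal (exp ((\<integral>t. \<psi> t \<partial>\<mu>) - KL_divergence (exp 1) \<pi> \<mu>))
      = ennreal (exp (\<integral>t. \<psi> t - ?L t \<partial>\<mu>))"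
    using \<psi> ent by simp
  also have "\<dots> \<le> (\<integral>\<^sup>+t. ennreal (exp (\<psi> t - ?L t)) \<partial>\<mu>)"
    using \<psi> ent by (intro \<mu>.exp_integral_le_nn_integral_exp) auto
  also have "\<dots> = (\<integral>\<^sup>+t. ?d t * ennreal (exp (\<psi> t - ?L t)) \<partial>\<pi>)"
    by (subst dens[symmetric], rule nn_integral_density) auto
  also have "\<dots> \<le> (\<integral>\<^sup>+t. ennreal (exp (\<psi> t)) \<partial>\<pi>)"
  proof (rule nn_integral_mono_AE)
    show "AE t in \<pi>. ?d t * ennreal (exp (\<psi> t - ?L t)) \<le> ennreal (exp (\<psi> t))"
      using fin
    proof eventually_elim
      case (elim t)
      then obtain r where r: "r \<ge> 0" "?d t = ennreal r" by (cases "?d t") auto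
      have "r * exp (\<psi> t - ln r) \<le> exp (\<psi> t)"
        using r(1) by (cases "r = 0") (auto simp: exp_diff)
      then show ?case
        using r by (simp add: entropy_density_def log_def ennreal_mult'[symmetric])
    qed
  qed
  finally show ?thesis .
qed

section \<open>Exponentially weighted means\<close>

text \<open>
  This makes the product of an estimator with its exponential weight bounded, so that the
  weighted mean exists even if the estimators are unbounded in \<open>t\<close>.
\<close>
lemma mult_exp_neg_square_le:
  fixes x \<beta> :: real
  assumes "\<beta> > 0"
  shows "x * exp (- x\<^sup>2 / \<beta>) \<le> 1 + \<beta>"
proof -
  have "x \<le> 1 + x\<^sup>2"
    using zero_le_power2[of "x - 1/2"] by (simp add: power2_eq_square algebra_simps)
  then have "x * exp (- x\<^sup>2 / \<beta>) \<le> (1 + x\<^sup>2) * exp (- x\<^sup>2 / \<beta>)" by (intro mult_right_mono) auto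
  also have "\<dots> = exp (- x\<^sup>2 / \<beta>) + x\<^sup>2 * exp (- x\<^sup>2 / \<beta>)" by (simp add: algebra_simps)
  also have "\<dots> \<le> 1 + \<beta>"
  proof (rule add_mono)
    show "exp (- x\<^sup>2 / \<beta>) \<le> 1" using assms by simp
    have "x\<^sup>2 / \<beta> \<le> exp (x\<^sup>2 / \<beta>)" using exp_ge_add_one_self[of "x\<^sup>2 / \<beta>"] by linarith
    then show "x\<^sup>2 * exp (- x\<^sup>2 / \<beta>) \<le> \<beta>"
      using assms by (simp add: exp_minus divide_simps mult.commute)
  qed
  finally show ?thesis .
qed

text \<open>
  The deterministic heart of the argument, for one fixed observation \<open>y = z + w\<close>. With
  \<open>D t = |z - f t|\<^sup>2\<close>, expanding \<open>|y - f t|\<^sup>2\<close> gives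
  \<open>r t - r s = D t - D s + p t - p s - 2 w \<bullet> (f t - f s)\<close>, so the exponent on the right-hand side
  separates into a function of \<open>t\<close> and a function of \<open>s\<close>:
  \<open>(1 - 2 \<gamma>) D t - r t\<close> plus \<open>r s - (1 + 2 \<gamma>) D s - p s\<close>. The double integral is therefore a product
  \<open>U V\<close>. Let \<open>Z\<close> be the normalising constant of the weights. By Jensen's inequality \<open>U / Z\<close> is
  at least the exponential of \<open>(1 - 2 \<gamma>) |z - m|\<^sup>2 / \<beta>\<close>. By the Cauchy--Schwarz inequality \<open>Z V\<close> is at least the square of
  an integral from which \<open>r\<close> has disappeared, and the Donsker--Varadhan inequality bounds that
  integral below; the square is the origin of the factor 2 in front of the divergence.
\<close>
lemma exp_weighted_mean_bound:
  fixes f :: "'t \<Rightarrow> 'b::euclidean_space" and p :: "'t \<Rightarrow> real" and \<pi> \<mu> :: "'t measure" and y z :: 'b and k \<beta> \<gamma> :: real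
  defines "r \<equiv> \<lambda>t. (norm (y - f t))\<^sup>2 + p t + k"
    and "D \<equiv> \<lambda>t. (norm (z - f t))\<^sup>2"
  defines "m \<equiv> (\<integral>t. f t \<partial>(density \<pi> (\<lambda>t. ennreal (exp (- r t / \<beta>) / (\<integral>t'. exp (- r t' / \<beta>) \<partial>\<pi>)))))"
  assumes \<pi>: "prob_space \<pi>"
    and f [measurable]: "f \<in> borel_measurable \<pi>"
    and p [measurable]: "p \<in> borel_measurable \<pi>" and p0: "\<And>t. t \<in> space \<pi> \<Longrightarrow> 0 \<le> p t"
    and \<beta>: "\<beta> > 0" and \<gamma>: "2 * \<gamma> \<le> 1"
    and \<mu>: "prob_space \<mu>" "sets \<mu> = sets \<pi>" "absolutely_continuous \<pi> \<mu>"
    and ent: "integrable \<mu> (entropy_density (exp 1) \<pi> \<mu>)"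
    and intD: "integrable \<mu> D" and intp: "integrable \<mu> p"
  shows "ennreal (exp (((1 - 2 * \<gamma>) * (norm (z - m))\<^sup>2 - (1 + 2 * \<gamma>) * (\<integral>t. D t \<partial>\<mu>) - (\<integral>t. p t \<partial>\<mu>)
            - 2 * \<beta> * KL_divergence (exp 1) \<pi> \<mu>) / \<beta>))
     \<le> (\<integral>\<^sup>+s. \<integral>\<^sup>+t. ennreal (exp ((2 * ((y - z) \<bullet> (f t - f s)) - p t - 2 * \<gamma> * (D t + D s)) / \<beta>)) \<partial>\<pi> \<partial>\<pi>)"
proof -
  interpret \<pi>: prob_space \<pi> by fact
  interpret \<mu>: prob_space \<mu> by fact
  have [measurable]: "r \<in> borel_measurable \<pi>" "D \<in> borel_measurable \<pi>"
    by (simp_all add: r_def D_def)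
  define E where "E t = exp (- r t / \<beta>)" for t
  have [measurable]: "E \<in> borel_measurable \<pi>" by (simp add: E_def[abs_def])
  define Z where "Z = (\<integral>t. E t \<partial>\<pi>)"
  have E0: "E t > 0" for t by (simp add: E_def)
  have Ele: "E t \<le> exp (- k / \<beta>) * exp (- (norm (y - f t))\<^sup>2 / \<beta>)" if "t \<in> space \<pi>" for t
    using p0[OF that] \<beta> by (simp add: E_def r_def exp_add[symmetric] divide_simps)
  have Ele1: "E t \<le> exp (- k / \<beta>)" if "t \<in> space \<pi>" for t
  proof -
    have "exp (- k / \<beta>) * exp (- (norm (y - f t))\<^sup>2 / \<beta>) \<le> exp (- k / \<beta>) * 1"
      using \<beta> by (intro mult_left_mono) auto
    with Ele[OF that] show ?thesis by linarith
  qed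
  have intE: "integrable \<pi> E"
    using E0 Ele1 by (intro \<pi>.integrable_const_bound[where B = "exp (- k / \<beta>)"])
      (auto intro!: AE_I2 simp: less_imp_le)
  have "Z \<noteq> 0"
  proof
    assume "Z = 0"
    then have "AE t in \<pi>. E t = 0"
      using integral_nonneg_eq_0_iff_AE[OF intE] E0 by (simp add: Z_def less_imp_le)
    then have "AE t in \<pi>. False" using E0 by (auto simp: less_le)
    then show False by (simp add: \<pi>.AE_False)
  qed
  moreover have "Z \<ge> 0" unfolding Z_def using E0 by (intro integral_nonneg_AE) (auto simp: less_imp_le)
  ultimately have Z: "Z > 0" by simp
  have nnE: "(\<integral>\<^sup>+t. ennreal (E t) \<partial>\<pi>) = ennreal Z"
    unfolding Z_def using intE E0 by (intro nn_integral_eq_integral) (auto simp: less_imp_le)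
  define \<rho> where "\<rho> = density \<pi> (\<lambda>t. ennreal (E t / Z))"
  have m: "m = (\<integral>t. f t \<partial>\<rho>)" by (simp add: m_def \<rho>_def E_def Z_def)
  have EZ: "ennreal (E t / Z) = ennreal (1 / Z) * ennreal (E t)" for t
    using Z E0[of t] by (simp add: ennreal_mult'[symmetric])
  have "emeasure \<rho> (space \<rho>) = ennreal (1 / Z) * ennreal Z"
    unfolding \<rho>_def by (simp add: emeasure_density EZ nn_integral_cmult nnE cong: nn_integral_cong)
  also have "\<dots> = 1" using Z by (simp add: ennreal_mult'[symmetric])
  finally interpret \<rho>: prob_space \<rho> by (rule prob_spaceI)
  have "integrable \<pi> (\<lambda>t. (E t / Z) *\<^sub>R f t)"
  proof (rule \<pi>.integrable_const_bound[where B = "exp (- k / \<beta>) * (norm y + (1 + \<beta>)) / Z"])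
    show "AE t in \<pi>. norm ((E t / Z) *\<^sub>R f t) \<le> exp (- k / \<beta>) * (norm y + (1 + \<beta>)) / Z"
    proof (rule AE_I2)
      fix t assume t: "t \<in> space \<pi>"
      let ?x = "norm (y - f t)"
      have "norm (f t) \<le> norm y + ?x"
        using norm_triangle_ineq4[of y "y - f t"] by simp
      then have "E t * norm (f t) \<le> exp (- k / \<beta>) * exp (- ?x\<^sup>2 / \<beta>) * (norm y + ?x)"
        using Ele[OF t] by (intro mult_mono) auto
      also have "\<dots> = exp (- k / \<beta>) * (norm y * exp (- ?x\<^sup>2 / \<beta>) + ?x * exp (- ?x\<^sup>2 / \<beta>))"
        by (simp add: algebra_simps)
      also have "\<dots> \<le> exp (- k / \<beta>) * (norm y * 1 + (1 + \<beta>))"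
        using \<beta> by (intro mult_left_mono add_mono mult_exp_neg_square_le) auto
      finally show "norm ((E t / Z) *\<^sub>R f t) \<le> exp (- k / \<beta>) * (norm y + (1 + \<beta>)) / Z"
        using Z E0[of t] by (simp add: divide_right_mono)
    qed
  qed simp
  then have intf: "integrable \<rho> f"
    unfolding \<rho>_def using Z E0 by (subst integrable_density) (auto simp: less_imp_le)

  \<comment> \<open>The factor in \<open>t\<close>: relative to \<open>Z\<close> it is an exponential moment under the weights.\<close>
  define U where "U = (\<integral>\<^sup>+t. ennreal (exp ((1 - 2 * \<gamma>) * D t / \<beta> - r t / \<beta>)) \<partial>\<pi>)"
  define V where "V = (\<integral>\<^sup>+s. ennreal (exp (- ((1 + 2 * \<gamma>) * D s + p s) / \<beta> + r s / \<beta>)) \<partial>\<pi>)"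
  let ?e1 = "exp ((1 - 2 * \<gamma>) / \<beta> * (norm (z - m))\<^sup>2)"
  have "ennreal ?e1 \<le> (\<integral>\<^sup>+t. ennreal (exp ((1 - 2 * \<gamma>) / \<beta> * D t)) \<partial>\<rho>)"
    unfolding m D_def using \<gamma> \<beta> by (intro \<rho>.exp_norm_mean_le_nn_integral_exp_norm intf) auto
  also have "\<dots> = (\<integral>\<^sup>+t. ennreal (1 / Z) * ennreal (exp ((1 - 2 * \<gamma>) * D t / \<beta> - r t / \<beta>)) \<partial>\<pi>)"
  proof -
    have "ennreal (E t / Z) * ennreal (exp ((1 - 2 * \<gamma>) / \<beta> * D t))
        = ennreal (1 / Z) * ennreal (exp ((1 - 2 * \<gamma>) * D t / \<beta> - r t / \<beta>))" for t
      unfolding EZ mult.assoc by (simp add: E_def ennreal_mult'[symmetric] exp_add[symmetric])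
    then show ?thesis
      unfolding \<rho>_def by (subst nn_integral_density) auto
  qed
  also have "\<dots> = ennreal (1 / Z) * U" by (simp add: nn_integral_cmult U_def)
  finally have "ennreal Z * ennreal ?e1 \<le> ennreal Z * (ennreal (1 / Z) * U)"
    by (intro mult_left_mono) auto
  also have "\<dots> = U" using Z by (simp add: mult.assoc[symmetric] ennreal_mult'[symmetric])
  finally have U: "ennreal Z * ennreal ?e1 \<le> U" .

  \<comment> \<open>The factor in \<open>s\<close>: splitting \<open>exp \<psi>\<close> into the square roots of the integrands of \<open>Z\<close> and \<open>V\<close>.\<close>
  define \<psi> where "\<psi> t = - ((1 + 2 * \<gamma>) * D t + p t) / (2 * \<beta>)" for t
  have [measurable]: "\<psi> \<in> borel_measurable \<pi>" by (simp add: \<psi>_def[abs_def])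
  have int\<psi>: "integrable \<mu> \<psi>" unfolding \<psi>_def using intD intp by auto
  let ?e2 = "exp ((\<integral>t. \<psi> t \<partial>\<mu>) - KL_divergence (exp 1) \<pi> \<mu>)"
  have "ennreal (?e2\<^sup>2) = (ennreal ?e2)\<^sup>2" by (simp add: ennreal_power)
  also have "\<dots> \<le> (\<integral>\<^sup>+t. ennreal (exp (\<psi> t)) \<partial>\<pi>)\<^sup>2"
    by (intro power_mono donsker_varadhan_le[OF \<pi> \<mu> ent int\<psi>]) auto
  also have "\<dots> = (\<integral>\<^sup>+t. ennreal (exp (- r t / (2 * \<beta>))) * ennreal (exp (\<psi> t + r t / (2 * \<beta>))) \<partial>\<pi>)\<^sup>2"
    by (simp add: ennreal_mult'[symmetric] exp_add[symmetric])
  also have "\<dots> \<le> (\<integral>\<^sup>+t. (ennreal (exp (- r t / (2 * \<beta>))))\<^sup>2 \<partial>\<pi>)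
      * (\<integral>\<^sup>+t. (ennreal (exp (\<psi> t + r t / (2 * \<beta>))))\<^sup>2 \<partial>\<pi>)"
    by (intro Cauchy_Schwarz_nn_integral) measurable
  also have "\<dots> = (\<integral>\<^sup>+t. ennreal (E t) \<partial>\<pi>) * V"
  proof -
    have sq: "(ennreal (exp x))\<^sup>2 = ennreal (exp (2 * x))" for x :: real
      by (simp add: ennreal_power exp_double)
    have half: "2 * (x / (2 * \<beta>)) = x / \<beta>" for x by simp
    have "2 * (- r t / (2 * \<beta>)) = - r t / \<beta>"
      "2 * (\<psi> t + r t / (2 * \<beta>)) = - ((1 + 2 * \<gamma>) * D t + p t) / \<beta> + r t / \<beta>" for t
      by (simp_all only: \<psi>_def distrib_left half)
    then show ?thesis by (simp only: sq E_def V_def)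
  qed
  finally have V: "ennreal (?e2\<^sup>2) \<le> ennreal Z * V" by (simp add: nnE)

  have "ennreal (exp (((1 - 2 * \<gamma>) * (norm (z - m))\<^sup>2 - (1 + 2 * \<gamma>) * (\<integral>t. D t \<partial>\<mu>) - (\<integral>t. p t \<partial>\<mu>)
            - 2 * \<beta> * KL_divergence (exp 1) \<pi> \<mu>) / \<beta>)) = ennreal (?e1 * ?e2\<^sup>2)"
  proof -
    have "(\<integral>t. \<psi> t \<partial>\<mu>) = - ((1 + 2 * \<gamma>) * (\<integral>t. D t \<partial>\<mu>) + (\<integral>t. p t \<partial>\<mu>)) / (2 * \<beta>)"
      unfolding \<psi>_def using intD intp by simp
    moreover have "?e2\<^sup>2 = exp (2 * ((\<integral>t. \<psi> t \<partial>\<mu>) - KL_divergence (exp 1) \<pi> \<mu>))"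
      by (rule exp_double[symmetric])
    ultimately show ?thesis using \<beta> by (simp add: exp_add[symmetric] field_simps)
  qed
  also have "\<dots> = ennreal ?e1 * ennreal (?e2\<^sup>2)" by (simp add: ennreal_mult')
  also have "\<dots> \<le> ennreal ?e1 * (ennreal Z * V)" by (intro mult_left_mono V) auto
  also have "\<dots> = (ennreal Z * ennreal ?e1) * V" by (simp add: mult_ac)
  also have "\<dots> \<le> U * V" by (intro mult_right_mono U) auto
  also have "\<dots> = (\<integral>\<^sup>+s. ennreal (exp (- ((1 + 2 * \<gamma>) * D s + p s) / \<beta> + r s / \<beta>)) * U \<partial>\<pi>)"
    unfolding V_def by (subst nn_integral_multc) (auto simp: mult.commute)
  also have "\<dots> = (\<integral>\<^sup>+s. \<integral>\<^sup>+t. ennreal (exp (- ((1 + 2 * \<gamma>) * D s + p s) / \<beta> + r s / \<beta>)) *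
       ennreal (exp ((1 - 2 * \<gamma>) * D t / \<beta> - r t / \<beta>)) \<partial>\<pi> \<partial>\<pi>)"
    unfolding U_def by (intro nn_integral_cong nn_integral_cmult[symmetric]) measurable
  also have "\<dots> = (\<integral>\<^sup>+s. \<integral>\<^sup>+t. ennreal (exp ((2 * ((y - z) \<bullet> (f t - f s)) - p t - 2 * \<gamma> * (D t + D s)) / \<beta>)) \<partial>\<pi> \<partial>\<pi>)"
  proof (intro nn_integral_cong)
    fix s t
    have r: "r t = (norm (y - z))\<^sup>2 + 2 * ((y - z) \<bullet> (z - f t)) + D t + p t + k" for t
    proof -
      have "(norm (y - f t))\<^sup>2 = (norm ((y - z) + (z - f t)))\<^sup>2" by simp
      also have "\<dots> = (norm (y - z))\<^sup>2 + 2 * ((y - z) \<bullet> (z - f t)) + D t"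
        unfolding D_def power2_norm_eq_inner inner_add_left inner_add_right
        by (simp only: inner_commute[of "z - f t" "y - z"] mult_2 add.assoc)
      finally show ?thesis by (simp add: r_def)
    qed
    have "- ((1 + 2 * \<gamma>) * D s + p s) + r s + ((1 - 2 * \<gamma>) * D t - r t)
      = 2 * ((y - z) \<bullet> (f t - f s)) - p t - 2 * \<gamma> * (D t + D s)"
      unfolding r by (simp add: inner_diff_right algebra_simps)
    then have "- ((1 + 2 * \<gamma>) * D s + p s) / \<beta> + r s / \<beta> + ((1 - 2 * \<gamma>) * D t / \<beta> - r t / \<beta>)
      = (2 * ((y - z) \<bullet> (f t - f s)) - p t - 2 * \<gamma> * (D t + D s)) / \<beta>"
      by (simp only: add_divide_distrib[symmetric] diff_divide_distrib[symmetric])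
    then show "ennreal (exp (- ((1 + 2 * \<gamma>) * D s + p s) / \<beta> + r s / \<beta>)) *
       ennreal (exp ((1 - 2 * \<gamma>) * D t / \<beta> - r t / \<beta>))
      = ennreal (exp ((2 * ((y - z) \<bullet> (f t - f s)) - p t - 2 * \<gamma> * (D t + D s)) / \<beta>))"
      by (simp only: ennreal_mult'[symmetric] exp_ge_zero exp_add[symmetric])
  qed
  finally show ?thesis .
qed

section \<open>Measurability of uncountable infima\<close>

text \<open>
  An infimum over an uncountable family is measurable here because each sublevel set is a union
  of open sets.
\<close>
lemma borel_measurable_INF_upper_semicontinuous:
  fixes G :: "'i \<Rightarrow> 'w::topological_space \<Rightarrow> ereal"
  assumes "\<And>i c. i \<in> I \<Longrightarrow> open {w. G i w < c}"
  shows "(\<lambda>w. INF i\<in>I. G i w) \<in> borel_measurable borel"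
proof (rule borel_measurableI_less)
  fix c
  have "{w \<in> space borel. (INF i\<in>I. G i w) < c} = (\<Union>i\<in>I. {w. G i w < c})"
    by (auto simp: INF_less_iff)
  then show "{w \<in> space borel. (INF i\<in>I. G i w) < c} \<in> sets borel"
    by (simp only:) (intro borel_open open_UN ballI assms)
qed

text \<open>
  As a function of \<open>w\<close>, the mean square is either infinite everywhere or finite and continuous,
  by dominated convergence, since \<open>h\<close> moves by at most \<open>norm (w - w')\<close> uniformly in \<open>t\<close>.
\<close>
lemma open_mean_square_sublevel:
  fixes h :: "'w::real_normed_vector \<Rightarrow> 't \<Rightarrow> 'b::euclidean_space"
  assumes \<mu>: "prob_space \<mu>"
    and h [measurable]: "\<And>w. h w \<in> borel_measurable \<mu>"
    and lip: "\<And>w w' t. t \<in> space \<mu> \<Longrightarrow> norm (h w t - h w' t) \<le> norm (w - w')"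
    and a: "a > 0" and C: "C \<noteq> -\<infinity>"
  shows "open {w. ereal a * enn2ereal (\<integral>\<^sup>+t. ennreal ((norm (h w t))\<^sup>2) \<partial>\<mu>) + C < c}"
proof -
  interpret prob_space \<mu> by fact
  have bound: "(norm (h w t))\<^sup>2 \<le> 2 * (norm (h w' t))\<^sup>2 + 2 * (norm (w - w'))\<^sup>2"
    if t: "t \<in> space \<mu>" for w w' t
  proof -
    have "norm (h w t) \<le> norm (h w' t) + norm (h w t - h w' t)"
      using norm_triangle_ineq[of "h w' t" "h w t - h w' t"] by simp
    also have "\<dots> \<le> norm (h w' t) + norm (w - w')" using lip[OF t] by simp
    finally have "(norm (h w t))\<^sup>2 \<le> (norm (h w' t) + norm (w - w'))\<^sup>2" by (intro power_mono) auto
    also have "\<dots> \<le> 2 * (norm (h w' t))\<^sup>2 + 2 * (norm (w - w'))\<^sup>2"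
      using sum_squares_bound[of "norm (h w' t)" "norm (w - w')"] by (simp add: power2_sum)
    finally show ?thesis .
  qed
  show ?thesis
  proof (cases "C = \<infinity> \<or> (\<forall>w. \<not> integrable \<mu> (\<lambda>t. (norm (h w t))\<^sup>2))")
    case True
    have "\<not> ereal a * enn2ereal (\<integral>\<^sup>+t. ennreal ((norm (h w t))\<^sup>2) \<partial>\<mu>) + C < c" for w
    proof (cases "C = \<infinity>")
      case False
      with True have "\<not> integrable \<mu> (\<lambda>t. (norm (h w t))\<^sup>2)" by auto
      then have "\<not> (\<integral>\<^sup>+t. ennreal ((norm (h w t))\<^sup>2) \<partial>\<mu>) < \<infinity>"
        by (rule contrapos_nn) (intro integrableI_bounded, auto)
      then have "(\<integral>\<^sup>+t. ennreal ((norm (h w t))\<^sup>2) \<partial>\<mu>) = \<infinity>" by (simp add: not_less top_unique)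
      then show ?thesis using a C by (cases C) auto
    qed simp
    then show ?thesis by simp
  next
    case False
    then obtain w\<^sub>0 C' where w0: "integrable \<mu> (\<lambda>t. (norm (h w\<^sub>0 t))\<^sup>2)" and C': "C = ereal C'"
      using C by (cases C) auto
    have int: "integrable \<mu> (\<lambda>t. (norm (h w t))\<^sup>2)" for w
      by (rule Bochner_Integration.integrable_bound[where f = "\<lambda>t. 2 * (norm (h w\<^sub>0 t))\<^sup>2 + 2 * (norm (w - w\<^sub>0))\<^sup>2"])
        (use w0 bound in auto)
    define g where "g w = (\<integral>t. (norm (h w t))\<^sup>2 \<partial>\<mu>)" for w
    have g: "(\<integral>\<^sup>+t. ennreal ((norm (h w t))\<^sup>2) \<partial>\<mu>) = ennreal (g w)" "g w \<ge> 0" for w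
      unfolding g_def by (auto intro!: nn_integral_eq_integral int)
    have "continuous_on UNIV g"
      unfolding continuous_on_sequentially
    proof (intro allI ballI impI)
      fix x :: "nat \<Rightarrow> 'w" and a
      assume "(\<forall>n. x n \<in> UNIV) \<and> x \<longlonglongrightarrow> a"
      then have x: "x \<longlonglongrightarrow> a" by simp
      then have "Bseq (\<lambda>n. x n - a)"
        by (intro convergent_imp_Bseq convergentI[where L = "a - a"] tendsto_intros)
      then obtain K where K: "\<And>n. norm (x n - a) \<le> K" by (auto elim!: BseqE)
      show "(g \<circ> x) \<longlonglongrightarrow> g a"
        unfolding o_def g_def
      proof (rule integral_dominated_convergence[where w = "\<lambda>t. 2 * (norm (h a t))\<^sup>2 + 2 * K\<^sup>2"])
        show "integrable \<mu> (\<lambda>t. 2 * (norm (h a t))\<^sup>2 + 2 * K\<^sup>2)" using int by auto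
        show "AE t in \<mu>. (\<lambda>n. (norm (h (x n) t))\<^sup>2) \<longlonglongrightarrow> (norm (h a t))\<^sup>2"
        proof (rule AE_I2)
          fix t assume t: "t \<in> space \<mu>"
          have "(\<lambda>n. norm (x n - a)) \<longlonglongrightarrow> 0" using x by (simp add: tendsto_norm_zero LIM_zero)
          then have "(\<lambda>n. h (x n) t - h a t) \<longlonglongrightarrow> 0"
            by (rule Lim_null_comparison[rotated]) (auto intro!: always_eventually lip t)
          then have "(\<lambda>n. h (x n) t) \<longlonglongrightarrow> h a t" by (rule LIM_zero_cancel)
          then show "(\<lambda>n. (norm (h (x n) t))\<^sup>2) \<longlonglongrightarrow> (norm (h a t))\<^sup>2" by (intro tendsto_intros)
        qed
        show "AE t in \<mu>. norm ((norm (h (x n) t))\<^sup>2) \<le> 2 * (norm (h a t))\<^sup>2 + 2 * K\<^sup>2" for n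
        proof (rule AE_I2)
          fix t assume t: "t \<in> space \<mu>"
          have "(norm (x n - a))\<^sup>2 \<le> K\<^sup>2" using K[of n] by (intro power_mono) auto
          then show "norm ((norm (h (x n) t))\<^sup>2) \<le> 2 * (norm (h a t))\<^sup>2 + 2 * K\<^sup>2"
            using bound[OF t, of "x n" a] by simp
        qed
      qed auto
    qed
    then have "open {w. ereal (a * g w + C') < c}"
      by (intro open_Collect_less continuous_intros)
    then show ?thesis using g by (simp add: C' g)
  qed
qed

section \<open>Aggregation of affine estimators\<close>

lemma borel_measurable_matrix_vector_mult [measurable (raw)]:
  fixes F :: "'a \<Rightarrow> real^'n^'m" and g :: "'a \<Rightarrow> real^'n"
  assumes "F \<in> borel_measurable N" "g \<in> borel_measurable N"
  shows "(\<lambda>x. F x *v g x) \<in> borel_measurable N"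
  using assms
  by (rule borel_measurable_continuous_Pair) (auto simp: matrix_vector_mult_def intro!: continuous_intros)

lemma borel_measurable_trace [measurable (raw)]:
  fixes F :: "'a \<Rightarrow> real^'n^'n"
  assumes "F \<in> borel_measurable N"
  shows "(\<lambda>x. trace (F x)) \<in> borel_measurable N"
proof -
  have "continuous_on UNIV (trace :: real^'n^'n \<Rightarrow> real)"
    unfolding trace_def by (intro continuous_intros)
  then show ?thesis
    using borel_measurable_continuous_onI assms measurable_compose by blast
qed

text \<open>
  The relation between \<open>\<beta>\<close> and \<open>\<gamma>\<close> is kept as the inequality that the exponential moment bound
  needs; the explicit root is substituted only at the very end.
\<close>
locale affine_aggregation = M: prob_space M + prior: prob_space \<pi>
  for M :: "'a measure" and \<pi> :: "'t measure" +
  fixes f0 b :: "real^'n" and W :: "'a \<Rightarrow> real^'n"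
    and A :: "'t \<Rightarrow> real^'n^'n" and c :: "'t \<Rightarrow> real^'n" and pen :: "'t \<Rightarrow> real"
    and \<sigma> \<beta> \<gamma> :: real
  assumes W_meas [measurable]: "W \<in> borel_measurable M"
    and A_meas [measurable]: "A \<in> borel_measurable \<pi>"
    and c_meas [measurable]: "c \<in> borel_measurable \<pi>"
    and pen_meas [measurable]: "pen \<in> borel_measurable \<pi>"
    and subgaussian: "\<And>v. (\<integral>\<^sup>+\<omega>. ennreal (exp (v \<bullet> W \<omega>)) \<partial>M) \<le> ennreal (exp (\<sigma>\<^sup>2 / 2 * (norm v)\<^sup>2))"
    and psd: "\<And>t. t \<in> space \<pi> \<Longrightarrow> pos_semidef (A t)"
    and contraction: "\<And>t x. t \<in> space \<pi> \<Longrightarrow> norm (A t *v x) \<le> norm x"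
    and pen_ge: "\<And>t. t \<in> space \<pi> \<Longrightarrow>
      pen t \<ge> 4 * \<sigma>\<^sup>2 / (\<beta> - 4 * \<sigma>\<^sup>2) * \<sigma>\<^sup>2 * trace (A t ** A t)"
    and \<beta>_gt: "\<beta> > 4 * \<sigma>\<^sup>2"
    and \<gamma>: "0 < \<gamma>" "2 * \<gamma> < 1" "2 * \<sigma>\<^sup>2 * (1 + 2 * \<gamma>)\<^sup>2 \<le> \<gamma> * (\<beta> - 4 * \<sigma>\<^sup>2)"
begin

abbreviation est :: "'a \<Rightarrow> 't \<Rightarrow> real^'n" where
  "est \<omega> t \<equiv> affine_est A b c (f0 + W \<omega>) t"

abbreviation loss :: "'a \<Rightarrow> 't \<Rightarrow> real" where
  "loss \<omega> t \<equiv> (norm (f0 - est \<omega> t))\<^sup>2"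

abbreviation cost :: "'t \<Rightarrow> real" where
  "cost t \<equiv> pen t + 2 * \<sigma>\<^sup>2 * trace (A t)"

abbreviation agg_loss :: "'a \<Rightarrow> real" where
  "agg_loss \<omega> \<equiv> (norm (f0 - ewa \<pi> \<beta> \<sigma> pen A b c (f0 + W \<omega>)))\<^sup>2"

text \<open>
  The single random variable that controls the aggregate against all competitors \<open>\<mu>\<close> at once: it
  does not depend on \<open>\<mu>\<close>, and its expectation is at most one.
\<close>
definition pair_moment :: "'a \<Rightarrow> ennreal" where
  "pair_moment \<omega> = (\<integral>\<^sup>+s. \<integral>\<^sup>+t. ennreal (exp ((2 * (W \<omega> \<bullet> (est \<omega> t - est \<omega> s)) - cost t
      - 2 * \<gamma> * (loss \<omega> t + loss \<omega> s)) / \<beta>)) \<partial>\<pi> \<partial>\<pi>)"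

lemma \<beta>_pos: "\<beta> > 0"
  using \<beta>_gt zero_le_power2[of \<sigma>] by linarith

lemma measurable_est [measurable (raw)]:
  assumes [measurable]: "g \<in> measurable N M" "h \<in> measurable N \<pi>"
  shows "(\<lambda>x. est (g x) (h x)) \<in> borel_measurable N"
  unfolding affine_est_def by measurable

lemma trace_nonneg: "t \<in> space \<pi> \<Longrightarrow> 0 \<le> trace (A t)"
  using psd[of t]
  by (auto simp: pos_semidef_def trace_def matrix_vector_mult_basis column_def inner_axis'
      intro!: sum_nonneg dest: spec[of _ "axis _ 1"])

lemma cost_nonneg:
  assumes "t \<in> space \<pi>"
  shows "0 \<le> cost t"
proof -
  have "transpose (A t) = A t" using psd[OF assms] by (simp add: pos_semidef_def)
  then have sym: "A t $ i $ j = A t $ j $ i" for i j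
  proof -
    have "A t $ i $ j = transpose (A t) $ j $ i" by (simp add: transpose_def)
    then show ?thesis by (simp only: \<open>transpose (A t) = A t\<close>)
  qed
  have "trace (A t ** A t) = (\<Sum>i\<in>UNIV. \<Sum>j\<in>UNIV. (A t $ i $ j)\<^sup>2)"
    unfolding trace_def matrix_matrix_mult_def
    by (intro sum.cong) (auto simp: power2_eq_square sym)
  then have "trace (A t ** A t) \<ge> 0" by (simp add: sum_nonneg)
  then have "4 * \<sigma>\<^sup>2 / (\<beta> - 4 * \<sigma>\<^sup>2) * \<sigma>\<^sup>2 * trace (A t ** A t) \<ge> 0"
    using \<beta>_gt by (intro mult_nonneg_nonneg divide_nonneg_nonneg) auto
  then have "pen t \<ge> 0" using pen_ge[OF assms] by linarith
  then show ?thesis using trace_nonneg[OF assms] by simp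
qed

text \<open>
  By the parallelogram law the two losses dominate half of \<open>|est \<omega> t - est \<omega> s|\<^sup>2\<close>, and the condition
  on the penalty makes \<open>cost t\<close> cancel the trace terms of the exponential moment bound.
\<close>
lemma pair_exponential_moment_le_1:
  assumes s: "s \<in> space \<pi>" and t: "t \<in> space \<pi>"
  shows "(\<integral>\<^sup>+\<omega>. ennreal (exp ((2 * (W \<omega> \<bullet> (est \<omega> t - est \<omega> s)) - cost t
      - 2 * \<gamma> * (loss \<omega> t + loss \<omega> s)) / \<beta>)) \<partial>M) \<le> 1"
proof -
  define d where "d = (A t - A s) *v (f0 - b) + (c t - c s)"
  let ?K = "(2 * \<sigma>\<^sup>2 * trace (A t) + 4 * \<sigma>\<^sup>2 / (\<beta> - 4 * \<sigma>\<^sup>2) * \<sigma>\<^sup>2 * trace (A t ** A t)) / \<beta>"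
  let ?h = "\<lambda>\<omega>. 2 * (W \<omega> \<bullet> ((A t - A s) *v W \<omega> + d)) - \<gamma> * (norm ((A t - A s) *v W \<omega> + d))\<^sup>2"
  have diff: "est \<omega> t - est \<omega> s = (A t - A s) *v W \<omega> + d" for \<omega>
  proof -
    have "f0 + W \<omega> - b = W \<omega> + (f0 - b)" by simp
    then show ?thesis
      by (simp only: affine_est_def d_def matrix_vector_right_distrib matrix_vector_mult_diff_rdistrib)
        simp
  qed
  have "?K \<le> cost t / \<beta>" using pen_ge[OF t] \<beta>_pos by (intro divide_right_mono) auto
  then have le: "(2 * (W \<omega> \<bullet> (est \<omega> t - est \<omega> s)) - cost t - 2 * \<gamma> * (loss \<omega> t + loss \<omega> s)) / \<beta>
      \<le> - ?K + ?h \<omega> / \<beta>" for \<omega>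
  proof -
    have "(norm (est \<omega> t - est \<omega> s))\<^sup>2 = (norm ((f0 - est \<omega> s) - (f0 - est \<omega> t)))\<^sup>2" by simp
    also have "\<dots> \<le> (norm (f0 - est \<omega> s) + norm (f0 - est \<omega> t))\<^sup>2"
      by (intro power_mono norm_triangle_ineq4) auto
    also have "\<dots> \<le> 2 * (loss \<omega> t + loss \<omega> s)"
      using sum_squares_bound[of "norm (f0 - est \<omega> s)" "norm (f0 - est \<omega> t)"] by (simp add: power2_sum)
    finally have "\<gamma> * (norm (est \<omega> t - est \<omega> s))\<^sup>2 \<le> \<gamma> * (2 * (loss \<omega> t + loss \<omega> s))"
      using \<gamma>(1) by (intro mult_left_mono) auto
    also have "\<dots> = 2 * \<gamma> * (loss \<omega> t + loss \<omega> s)" by (simp add: algebra_simps)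
    finally have "(2 * (W \<omega> \<bullet> (est \<omega> t - est \<omega> s)) - cost t - 2 * \<gamma> * (loss \<omega> t + loss \<omega> s)) / \<beta>
       \<le> (- cost t + ?h \<omega>) / \<beta>"
      using \<beta>_pos unfolding diff by (intro divide_right_mono) auto
    also have "\<dots> = - (cost t / \<beta>) + ?h \<omega> / \<beta>"
      by (simp only: add_divide_distrib minus_divide_left[symmetric])
    finally show ?thesis using \<open>?K \<le> cost t / \<beta>\<close> by linarith
  qed
  have "(\<integral>\<^sup>+\<omega>. ennreal (exp ((2 * (W \<omega> \<bullet> (est \<omega> t - est \<omega> s)) - cost t
      - 2 * \<gamma> * (loss \<omega> t + loss \<omega> s)) / \<beta>)) \<partial>M)
    \<le> (\<integral>\<^sup>+\<omega>. ennreal (exp (- ?K)) * ennreal (exp (?h \<omega> / \<beta>)) \<partial>M)"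
    using le by (intro nn_integral_mono)
      (simp only: ennreal_mult'[symmetric] exp_ge_zero exp_add[symmetric] ennreal_leI exp_le_cancel_iff)
  also have "\<dots> = ennreal (exp (- ?K)) * (\<integral>\<^sup>+\<omega>. ennreal (exp (?h \<omega> / \<beta>)) \<partial>M)"
    by (intro nn_integral_cmult) measurable
  also have "\<dots> \<le> ennreal (exp (- ?K)) * ennreal (exp ?K)"
    by (intro mult_left_mono subgaussian_affine_pair_exp_moment M.sigma_finite_measure_axioms W_meas
        subgaussian psd contraction s t \<beta>_gt \<gamma>(3) less_imp_le[OF \<gamma>(1)]) auto
  also have "\<dots> = 1" by (simp only: ennreal_mult'[symmetric] exp_ge_zero exp_add[symmetric]) simp
  finally show ?thesis .
qed

lemma pair_moment_measurable [measurable]: "pair_moment \<in> borel_measurable M"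
  unfolding pair_moment_def[abs_def] by measurable

lemma expectation_pair_moment_le_1: "(\<integral>\<^sup>+\<omega>. pair_moment \<omega> \<partial>M) \<le> 1"
proof -
  interpret P: pair_sigma_finite M \<pi> ..
  let ?e = "\<lambda>\<omega> s t. ennreal (exp ((2 * (W \<omega> \<bullet> (est \<omega> t - est \<omega> s)) - cost t
      - 2 * \<gamma> * (loss \<omega> t + loss \<omega> s)) / \<beta>))"
  have "(\<integral>\<^sup>+\<omega>. pair_moment \<omega> \<partial>M) = (\<integral>\<^sup>+s. \<integral>\<^sup>+\<omega>. \<integral>\<^sup>+t. ?e \<omega> s t \<partial>\<pi> \<partial>M \<partial>\<pi>)"
    unfolding pair_moment_def by (rule P.Fubini'[symmetric]) measurable
  also have "\<dots> = (\<integral>\<^sup>+s. \<integral>\<^sup>+t. \<integral>\<^sup>+\<omega>. ?e \<omega> s t \<partial>M \<partial>\<pi> \<partial>\<pi>)"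
    by (intro nn_integral_cong P.Fubini'[symmetric]) measurable
  also have "\<dots> \<le> (\<integral>\<^sup>+s. \<integral>\<^sup>+t. 1 \<partial>\<pi> \<partial>\<pi>)"
    by (intro nn_integral_mono pair_exponential_moment_le_1)
  also have "\<dots> = 1" by (simp add: prior.emeasure_space_1)
  finally show ?thesis .
qed

lemma agg_loss_measurable [measurable]: "agg_loss \<in> borel_measurable M"
proof -
  have [measurable]: "(\<lambda>x. pen_risk_est \<sigma> pen A b c (f0 + W (fst x)) (snd x)) \<in> borel_measurable (M \<Otimes>\<^sub>M \<pi>)"
    unfolding pen_risk_est_def risk_est_def by measurable
  have [measurable]: "(\<lambda>t. pen_risk_est \<sigma> pen A b c (f0 + W \<omega>) t) \<in> borel_measurable \<pi>"
    if "\<omega> \<in> space M" for \<omega>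
    using that unfolding pen_risk_est_def risk_est_def by measurable
  have [measurable]: "(\<lambda>t. est \<omega> t) \<in> borel_measurable \<pi>" if "\<omega> \<in> space M" for \<omega>
    using that by measurable
  \<comment> \<open>The reference measure of the integral defining the aggregate depends on \<open>\<omega>\<close>; with the density
    moved into the integrand it is the fixed prior.\<close>
  have eq: "ewa \<pi> \<beta> \<sigma> pen A b c (f0 + W \<omega>) =
      (\<integral>t. (exp (- pen_risk_est \<sigma> pen A b c (f0 + W \<omega>) t / \<beta>)
         / (\<integral>t'. exp (- pen_risk_est \<sigma> pen A b c (f0 + W \<omega>) t' / \<beta>) \<partial>\<pi>)) *\<^sub>R est \<omega> t \<partial>\<pi>)"
    if "\<omega> \<in> space M" for \<omega>
    using that unfolding ewa_def ewa_measure_def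
    by (intro integral_density) (auto intro!: AE_I2 divide_nonneg_nonneg integral_nonneg)
  have "(\<lambda>\<omega>. (\<integral>t. (exp (- pen_risk_est \<sigma> pen A b c (f0 + W \<omega>) t / \<beta>)
         / (\<integral>t'. exp (- pen_risk_est \<sigma> pen A b c (f0 + W \<omega>) t' / \<beta>) \<partial>\<pi>)) *\<^sub>R est \<omega> t \<partial>\<pi>))
      \<in> borel_measurable M"
    unfolding pen_risk_est_def risk_est_def by measurable
  then have "(\<lambda>\<omega>. ewa \<pi> \<beta> \<sigma> pen A b c (f0 + W \<omega>)) \<in> borel_measurable M"
    by (subst measurable_cong[OF eq])
  then show ?thesis by measurable
qed

lemma agg_loss_exp_le_pair_moment:
  assumes \<omega>: "\<omega> \<in> space M"
    and \<mu>: "prob_space \<mu>" "sets \<mu> = sets \<pi>" "absolutely_continuous \<pi> \<mu>"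
    and ent: "integrable \<mu> (entropy_density (exp 1) \<pi> \<mu>)"
    and int: "integrable \<mu> (loss \<omega>)" "integrable \<mu> cost"
  shows "ennreal (exp (((1 - 2 * \<gamma>) * agg_loss \<omega> - (1 + 2 * \<gamma>) * (\<integral>t. loss \<omega> t \<partial>\<mu>) - (\<integral>t. cost t \<partial>\<mu>)
            - 2 * \<beta> * KL_divergence (exp 1) \<pi> \<mu>) / \<beta>)) \<le> pair_moment \<omega>"
proof -
  have "pen_risk_est \<sigma> pen A b c (f0 + W \<omega>) t =
      (norm ((f0 + W \<omega>) - est \<omega> t))\<^sup>2 + cost t + (- real CARD('n) * \<sigma>\<^sup>2)" for t
    by (simp add: pen_risk_est_def risk_est_def)
  moreover have "est \<omega> \<in> borel_measurable \<pi>" using \<omega> by measurable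
  ultimately show ?thesis
    using exp_weighted_mean_bound[of \<pi> "est \<omega>" cost \<beta> \<gamma> \<mu> f0 "f0 + W \<omega>" "- real CARD('n) * \<sigma>\<^sup>2"]
      prior.prob_space_axioms cost_nonneg \<beta>_pos \<gamma> \<mu> ent int
    by (simp add: pair_moment_def ewa_def ewa_measure_def)
qed

text \<open>
  A finite divergence is nonnegative: this is the Donsker--Varadhan inequality for the zero
  function.
\<close>
lemma kl_div_cases:
  assumes "prob_space \<mu>" "sets \<mu> = sets \<pi>"
  obtains "kl_div \<mu> \<pi> = \<infinity>"
  | "absolutely_continuous \<pi> \<mu>" "integrable \<mu> (entropy_density (exp 1) \<pi> \<mu>)"
    "kl_div \<mu> \<pi> = ereal (KL_divergence (exp 1) \<pi> \<mu>)" "KL_divergence (exp 1) \<pi> \<mu> \<ge> 0"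
proof (cases "absolutely_continuous \<pi> \<mu> \<and> integrable \<mu> (entropy_density (exp 1) \<pi> \<mu>)")
  case True
  have "ennreal (exp ((\<integral>t. 0 \<partial>\<mu>) - KL_divergence (exp 1) \<pi> \<mu>)) \<le> (\<integral>\<^sup>+t. ennreal (exp 0) \<partial>\<pi>)"
    using assms True prior.prob_space_axioms by (intro donsker_varadhan_le) auto
  then have "KL_divergence (exp 1) \<pi> \<mu> \<ge> 0" by (simp add: prior.emeasure_space_1)
  with True that(2) show thesis by (simp add: kl_div_def)
next
  case False
  with that(1) show thesis by (simp add: kl_div_def)
qed

lemma solve_for_loss:
  assumes "(1 - 2 * \<gamma>) * L \<le> (1 + 2 * \<gamma>) * x + y + z"
  shows "L \<le> (1 + 4 * \<gamma> / (1 - 2 * \<gamma>)) * x + (1 + 2 * \<gamma> / (1 - 2 * \<gamma>)) * y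
      + (1 + 2 * \<gamma> / (1 - 2 * \<gamma>)) * z"
proof -
  have "L \<le> ((1 + 2 * \<gamma>) * x + y + z) / (1 - 2 * \<gamma>)"
    using assms \<gamma> by (simp add: le_divide_eq mult.commute)
  moreover have ab: "1 + 4 * \<gamma> / (1 - 2 * \<gamma>) = (1 + 2 * \<gamma>) / (1 - 2 * \<gamma>)"
    "1 + 2 * \<gamma> / (1 - 2 * \<gamma>) = 1 / (1 - 2 * \<gamma>)"
    using \<gamma> by (simp_all add: divide_simps)
  ultimately show ?thesis unfolding ab by (simp add: add_divide_distrib distrib_right)
qed

text \<open>
  Taking logarithms in the deterministic bound. If the divergence or one of the two integrals is
  infinite, then so is the right-hand side, because no term equals \<open>-\<infinity>\<close>.
\<close>
lemma agg_loss_le_of_pair_moment_le: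
  assumes \<omega>: "\<omega> \<in> space M" and \<mu>: "prob_space \<mu>" "sets \<mu> = sets \<pi>"
    and \<eta>: "0 < \<eta>" and X: "pair_moment \<omega> \<le> ennreal (1 / \<eta>)"
  shows "ereal (agg_loss \<omega>)
    \<le> ereal (1 + 4 * \<gamma> / (1 - 2 * \<gamma>)) * enn2ereal (\<integral>\<^sup>+ t. ennreal (loss \<omega> t) \<partial>\<mu>)
      + ereal (1 + 2 * \<gamma> / (1 - 2 * \<gamma>)) * enn2ereal (\<integral>\<^sup>+ t. ennreal (cost t) \<partial>\<mu>)
      + ereal (\<beta> * (1 + 2 * \<gamma> / (1 - 2 * \<gamma>))) * (2 * kl_div \<mu> \<pi> + ereal (ln (1 / \<eta>)))"
  (is "_ \<le> ereal ?a * enn2ereal ?I + ereal ?b * enn2ereal ?J + ereal (\<beta> * ?b) * _")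
proof -
  have a: "?a > 0" and b: "?b > 0" using \<gamma> by (auto intro!: add_pos_nonneg)
  have \<beta>b: "\<beta> * ?b > 0" using b \<beta>_pos by simp
  have IJ: "enn2ereal ?I \<noteq> -\<infinity>" "enn2ereal ?J \<noteq> -\<infinity>" by auto
  have space: "space \<mu> = space \<pi>" using sets_eq_imp_space_eq[OF \<mu>(2)] .
  note [measurable_cong] = \<mu>(2)
  have meas: "loss \<omega> \<in> borel_measurable \<mu>" using \<omega> by measurable
  from kl_div_cases[OF \<mu>] show ?thesis
  proof cases
    case 1
    then show ?thesis using a b \<beta>b IJ by (cases "enn2ereal ?I"; cases "enn2ereal ?J") auto
  next
    case 2
    let ?k = "KL_divergence (exp 1) \<pi> \<mu>"
    show ?thesis
    proof (cases "?I = \<infinity> \<or> ?J = \<infinity>")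
      case True
      then show ?thesis using a b 2 IJ by (cases "enn2ereal ?I"; cases "enn2ereal ?J") auto
    next
      case False
      have int: "integrable \<mu> (loss \<omega>)" "integrable \<mu> cost"
        using False meas cost_nonneg space
        by (auto intro!: integrableI_nonneg AE_I2 simp: less_top)
      let ?l = "\<integral>t. loss \<omega> t \<partial>\<mu>" and ?q = "\<integral>t. cost t \<partial>\<mu>"
      have I: "?I = ennreal ?l" and J: "?J = ennreal ?q"
        using int cost_nonneg space by (auto intro!: nn_integral_eq_integral AE_I2)
      have l0: "?l \<ge> 0" and q0: "?q \<ge> 0"
        using cost_nonneg space by (auto intro!: integral_nonneg_AE AE_I2)
      let ?x = "(1 - 2 * \<gamma>) * agg_loss \<omega> - (1 + 2 * \<gamma>) * ?l - ?q - 2 * \<beta> * ?k"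
      have "ennreal (exp (?x / \<beta>)) \<le> ennreal (1 / \<eta>)"
        using agg_loss_exp_le_pair_moment[OF \<omega> \<mu> 2(1,2) int] X by (rule order_trans)
      then have "exp (?x / \<beta>) \<le> 1 / \<eta>" using \<eta> by simp
      then have "?x / \<beta> \<le> ln (1 / \<eta>)" using \<eta> by (simp add: ln_ge_iff)
      then have "?x \<le> \<beta> * ln (1 / \<eta>)" using \<beta>_pos by (simp add: divide_le_eq mult.commute)
      then have "(1 - 2 * \<gamma>) * agg_loss \<omega>
          \<le> (1 + 2 * \<gamma>) * ?l + ?q + \<beta> * (2 * ?k + ln (1 / \<eta>))" by (simp add: algebra_simps)
      from solve_for_loss[OF this]
      have "agg_loss \<omega> \<le> ?a * ?l + ?b * ?q + \<beta> * ?b * (2 * ?k + ln (1 / \<eta>))"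
        by (simp only: mult.assoc mult.left_commute[of \<beta>])
      then show ?thesis unfolding I J 2(3) using l0 q0 by (simp add: enn2ereal_ennreal)
    qed
  qed
qed

text \<open>
  With \<open>1 + x \<le> exp x\<close> in place of the logarithm, the deterministic bound becomes linear in
  \<open>pair_moment\<close> and can be integrated over \<open>\<omega>\<close>. The constant \<open>\<beta>\<close> is carried along on both sides to
  keep the integrands nonnegative; it cancels because the expectation of \<open>pair_moment\<close> is at most
  one.
\<close>
lemma expectation_agg_loss_le:
  assumes \<mu>: "prob_space \<mu>" "sets \<mu> = sets \<pi>"
  shows "enn2ereal (\<integral>\<^sup>+\<omega>. ennreal (agg_loss \<omega>) \<partial>M)
    \<le> ereal (1 + 4 * \<gamma> / (1 - 2 * \<gamma>))
         * enn2ereal (\<integral>\<^sup>+ t. (\<integral>\<^sup>+\<omega>. ennreal (loss \<omega> t) \<partial>M) \<partial>\<mu>)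
      + ereal (1 + 2 * \<gamma> / (1 - 2 * \<gamma>)) * enn2ereal (\<integral>\<^sup>+ t. ennreal (cost t) \<partial>\<mu>)
      + ereal (2 * \<beta> * (1 + 2 * \<gamma> / (1 - 2 * \<gamma>))) * kl_div \<mu> \<pi>"
  (is "enn2ereal ?L \<le> ereal ?a * enn2ereal ?I + ereal ?b * enn2ereal ?J + ereal (2 * \<beta> * ?b) * _")
proof -
  interpret \<mu>: prob_space \<mu> by fact
  interpret P: pair_sigma_finite M \<mu> ..
  have a: "?a > 0" and b: "?b > 0" using \<gamma> by (auto intro!: add_pos_nonneg)
  have \<beta>b: "2 * \<beta> * ?b > 0" using b \<beta>_pos by simp
  have IJ: "enn2ereal ?I \<noteq> -\<infinity>" "enn2ereal ?J \<noteq> -\<infinity>" by auto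
  have space: "space \<mu> = space \<pi>" using sets_eq_imp_space_eq[OF \<mu>(2)] .
  note [measurable_cong] = \<mu>(2)
  from kl_div_cases[OF \<mu>] show ?thesis
  proof cases
    case 1
    then show ?thesis using a b \<beta>b IJ by (cases "enn2ereal ?I"; cases "enn2ereal ?J") auto
  next
    case 2
    let ?k = "KL_divergence (exp 1) \<pi> \<mu>"
    show ?thesis
    proof (cases "?I = \<infinity> \<or> ?J = \<infinity>")
      case True
      then show ?thesis using a b 2 IJ by (cases "enn2ereal ?I"; cases "enn2ereal ?J") auto
    next
      case False
      then obtain i where i: "?I = ennreal i" "i \<ge> 0" by (cases ?I) auto
      have intc: "integrable \<mu> cost"
        using False cost_nonneg space by (auto intro!: integrableI_nonneg AE_I2 simp: less_top)
      let ?q = "\<integral>t. cost t \<partial>\<mu>"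
      have J: "?J = ennreal ?q"
        using intc cost_nonneg space by (auto intro!: nn_integral_eq_integral AE_I2)
      have q0: "?q \<ge> 0" using cost_nonneg space by (auto intro!: integral_nonneg_AE AE_I2)
      let ?Q = "?q + 2 * \<beta> * ?k"
      have Q0: "?Q \<ge> 0" using q0 2(4) \<beta>_pos by simp
      have pt: "ennreal (1 - 2 * \<gamma>) * ennreal (agg_loss \<omega>) + ennreal \<beta>
          \<le> ennreal (1 + 2 * \<gamma>) * (\<integral>\<^sup>+t. ennreal (loss \<omega> t) \<partial>\<mu>) + ennreal ?Q + ennreal \<beta> * pair_moment \<omega>"
        if \<omega>: "\<omega> \<in> space M" for \<omega>
      proof (cases "(\<integral>\<^sup>+t. ennreal (loss \<omega> t) \<partial>\<mu>) = \<infinity>")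
        case True
        then show ?thesis using \<gamma> by (simp add: ennreal_mult_top)
      next
        case False
        have meas: "loss \<omega> \<in> borel_measurable \<mu>" using \<omega> by measurable
        have intl: "integrable \<mu> (loss \<omega>)"
          using False meas by (auto intro!: integrableI_nonneg AE_I2 simp: less_top)
        let ?l = "\<integral>t. loss \<omega> t \<partial>\<mu>"
        have I: "(\<integral>\<^sup>+t. ennreal (loss \<omega> t) \<partial>\<mu>) = ennreal ?l"
          using intl by (auto intro!: nn_integral_eq_integral)
        have l0: "?l \<ge> 0" by (auto intro!: integral_nonneg_AE)
        let ?x = "(1 - 2 * \<gamma>) * agg_loss \<omega> - (1 + 2 * \<gamma>) * ?l - ?q - 2 * \<beta> * ?k"
        have "ennreal (1 + ?x / \<beta>) \<le> ennreal (exp (?x / \<beta>))"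
          by (intro ennreal_leI exp_ge_add_one_self)
        also have "\<dots> \<le> pair_moment \<omega>"
          by (rule agg_loss_exp_le_pair_moment[OF \<omega> \<mu> 2(1,2) intl intc])
        finally have "ennreal \<beta> * ennreal (1 + ?x / \<beta>) \<le> ennreal \<beta> * pair_moment \<omega>"
          by (intro mult_left_mono) auto
        also have "ennreal \<beta> * ennreal (1 + ?x / \<beta>) = ennreal (\<beta> + ?x)"
          using \<beta>_pos by (simp add: ennreal_mult'[symmetric] distrib_left)
        finally have X: "ennreal (\<beta> + ?x) \<le> ennreal \<beta> * pair_moment \<omega>" .
        let ?y = "(1 + 2 * \<gamma>) * ?l + ?Q"
        have y0: "(1 + 2 * \<gamma>) * ?l \<ge> 0" using l0 \<gamma> by simp
        have "ennreal (1 - 2 * \<gamma>) * ennreal (agg_loss \<omega>) + ennreal \<beta>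
            = ennreal ((1 - 2 * \<gamma>) * agg_loss \<omega> + \<beta>)"
          using \<gamma> \<beta>_pos by (simp add: ennreal_mult'[symmetric])
        also have "\<dots> \<le> ennreal (?y + max 0 (\<beta> + ?x))" by (intro ennreal_leI) simp
        also have "\<dots> = ennreal ?y + ennreal (max 0 (\<beta> + ?x))"
          using y0 Q0 by (intro ennreal_plus) auto
        also have "ennreal (max 0 (\<beta> + ?x)) = ennreal (\<beta> + ?x)" by (auto simp: max_def ennreal_neg)
        also have "ennreal ?y = ennreal (1 + 2 * \<gamma>) * (\<integral>\<^sup>+t. ennreal (loss \<omega> t) \<partial>\<mu>) + ennreal ?Q"
          unfolding I using y0 Q0 l0 \<gamma> by (simp add: ennreal_mult'[symmetric] del: ennreal_plus
              add: ennreal_plus[symmetric])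
        finally show ?thesis using X by (meson add_left_mono order_trans)
      qed
      have "ennreal (1 - 2 * \<gamma>) * ?L + ennreal \<beta>
          = (\<integral>\<^sup>+\<omega>. ennreal (1 - 2 * \<gamma>) * ennreal (agg_loss \<omega>) + ennreal \<beta> \<partial>M)"
        by (subst nn_integral_add) (auto simp: nn_integral_cmult M.emeasure_space_1)
      also have "\<dots> \<le> (\<integral>\<^sup>+\<omega>. ennreal (1 + 2 * \<gamma>) * (\<integral>\<^sup>+t. ennreal (loss \<omega> t) \<partial>\<mu>) + ennreal ?Q
          + ennreal \<beta> * pair_moment \<omega> \<partial>M)"
        by (intro nn_integral_mono pt)
      also have "\<dots> = ennreal (1 + 2 * \<gamma>) * (\<integral>\<^sup>+\<omega>. \<integral>\<^sup>+t. ennreal (loss \<omega> t) \<partial>\<mu> \<partial>M) + ennreal ?Q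
          + ennreal \<beta> * (\<integral>\<^sup>+\<omega>. pair_moment \<omega> \<partial>M)"
        by (simp add: nn_integral_add nn_integral_cmult M.emeasure_space_1)
      also have "(\<integral>\<^sup>+\<omega>. \<integral>\<^sup>+t. ennreal (loss \<omega> t) \<partial>\<mu> \<partial>M) = ?I"
        by (rule P.Fubini'[symmetric]) measurable
      also have "ennreal (1 + 2 * \<gamma>) * ?I + ennreal ?Q + ennreal \<beta> * (\<integral>\<^sup>+\<omega>. pair_moment \<omega> \<partial>M)
          \<le> ennreal (1 + 2 * \<gamma>) * ?I + ennreal ?Q + ennreal \<beta> * 1"
        by (intro add_left_mono mult_left_mono expectation_pair_moment_le_1) auto
      also have "\<dots> = ennreal ((1 + 2 * \<gamma>) * i + ?Q + \<beta>)"
        using i Q0 \<gamma> \<beta>_pos by (simp add: ennreal_mult'[symmetric] del: ennreal_plus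
            add: ennreal_plus[symmetric])
      finally have main: "ennreal (1 - 2 * \<gamma>) * ?L + ennreal \<beta> \<le> ennreal ((1 + 2 * \<gamma>) * i + ?Q + \<beta>)" .
      obtain l where l: "?L = ennreal l" "l \<ge> 0"
      proof (cases ?L)
        case top
        with main \<gamma> have "\<top> \<le> ennreal ((1 + 2 * \<gamma>) * i + ?Q + \<beta>)" by (simp add: ennreal_mult_top)
        then show thesis by (simp add: top_unique)
      qed (use that in auto)
      have "ennreal ((1 - 2 * \<gamma>) * l + \<beta>) \<le> ennreal ((1 + 2 * \<gamma>) * i + ?Q + \<beta>)"
        using main \<gamma> \<beta>_pos l by (simp add: ennreal_mult'[symmetric] del: ennreal_plus
            add: ennreal_plus[symmetric])
      then have "(1 - 2 * \<gamma>) * l + \<beta> \<le> (1 + 2 * \<gamma>) * i + ?Q + \<beta>"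
        using \<gamma> i Q0 \<beta>_pos by (subst (asm) ennreal_le_iff) auto
      then have "(1 - 2 * \<gamma>) * l \<le> (1 + 2 * \<gamma>) * i + ?q + 2 * \<beta> * ?k" by simp
      from solve_for_loss[OF this]
      have "l \<le> ?a * i + ?b * ?q + 2 * \<beta> * ?b * ?k"
        by (simp only: mult_ac)
      then show ?thesis unfolding i(1) J l(1) 2(3) using l i q0 by (simp add: enn2ereal_ennreal)
    qed
  qed
qed

end

section \<open>The oracle inequalities\<close>

theorem theorem4p1:
  fixes M :: "'a measure" and T :: "'t measure" and \<pi> :: "'t measure"
    and f0 b :: "real^'n" and W :: "'a \<Rightarrow> real^'n"
    and A :: "'t \<Rightarrow> real^'n^'n" and c :: "'t \<Rightarrow> real^'n" and pen :: "'t \<Rightarrow> real"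
    and \<sigma> \<beta> \<gamma> :: real
  assumes "prob_space M"
    and "\<sigma> > 0"
    and W_meas: "W \<in> borel_measurable M"
    and W_mean: "integrable M W" "(\<integral>\<omega>. W \<omega> \<partial>M) = 0"
    and W_subgauss: "\<And>\<alpha>. integrable M (\<lambda>\<omega>. exp (\<alpha> \<bullet> W \<omega>))"
      "\<And>\<alpha>. (\<integral>\<omega>. exp (\<alpha> \<bullet> W \<omega>) \<partial>M) \<le> exp (\<sigma>\<^sup>2 / 2 * (norm \<alpha>)\<^sup>2)"
    and A_meas: "A \<in> borel_measurable T"
    and c_meas: "c \<in> borel_measurable T"
    and pen_meas: "pen \<in> borel_measurable T"
    and prior: "\<pi> \<in> space (prob_algebra T)"
    and A_psd: "\<And>t. t \<in> space T \<Longrightarrow> pos_semidef (A t)"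
    and A_norm: "(SUP t\<in>space T. ereal (onorm (\<lambda>x. A t *v x))) \<le> 1"
    and \<beta>: "\<beta> > 20 * \<sigma>\<^sup>2"
    and \<gamma>: "\<gamma> = (\<beta> - 12 * \<sigma>\<^sup>2 - sqrt (\<beta> - 4 * \<sigma>\<^sup>2) * sqrt (\<beta> - 20 * \<sigma>\<^sup>2)) / (16 * \<sigma>\<^sup>2)"
    and pen: "\<And>t. t \<in> space T \<Longrightarrow>
      pen t \<ge> 4 * \<sigma>\<^sup>2 / (\<beta> - 4 * \<sigma>\<^sup>2) * \<sigma>\<^sup>2 * trace (A t ** A t)"
  shows "(\<forall>\<eta>. 0 < \<eta> \<and> \<eta> \<le> 1 \<longrightarrow>
      measure M {\<omega> \<in> space M.
        ereal ((norm (f0 - ewa \<pi> \<beta> \<sigma> pen A b c (f0 + W \<omega>)))\<^sup>2)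
        \<le> (INF \<mu>\<in>space (prob_algebra T).
            ereal (1 + 4 * \<gamma> / (1 - 2 * \<gamma>))
              * enn2ereal (\<integral>\<^sup>+ t. ennreal ((norm (f0 - affine_est A b c (f0 + W \<omega>) t))\<^sup>2) \<partial>\<mu>)
          + ereal (1 + 2 * \<gamma> / (1 - 2 * \<gamma>))
              * enn2ereal (\<integral>\<^sup>+ t. ennreal (pen t + 2 * \<sigma>\<^sup>2 * trace (A t)) \<partial>\<mu>)
          + ereal (\<beta> * (1 + 2 * \<gamma> / (1 - 2 * \<gamma>))) * (2 * kl_div \<mu> \<pi> + ereal (ln (1 / \<eta>))))}
      \<ge> 1 - \<eta>)
    \<and> enn2ereal (\<integral>\<^sup>+ \<omega>. ennreal ((norm (f0 - ewa \<pi> \<beta> \<sigma> pen A b c (f0 + W \<omega>)))\<^sup>2) \<partial>M)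
        \<le> (INF \<mu>\<in>space (prob_algebra T).
            ereal (1 + 4 * \<gamma> / (1 - 2 * \<gamma>))
              * enn2ereal (\<integral>\<^sup>+ t. (\<integral>\<^sup>+ \<omega>. ennreal ((norm (f0 - affine_est A b c (f0 + W \<omega>) t))\<^sup>2) \<partial>M) \<partial>\<mu>)
          + ereal (1 + 2 * \<gamma> / (1 - 2 * \<gamma>))
              * enn2ereal (\<integral>\<^sup>+ t. ennreal (pen t + 2 * \<sigma>\<^sup>2 * trace (A t)) \<partial>\<mu>)
          + ereal (2 * \<beta> * (1 + 2 * \<gamma> / (1 - 2 * \<gamma>))) * kl_div \<mu> \<pi>)"
proof -
  interpret M: prob_space M by fact
  have sets_\<pi>: "sets \<pi> = sets T" and prob_\<pi>: "prob_space \<pi>"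
    using prior by (auto simp: space_prob_algebra)
  have space_\<pi>: "space \<pi> = space T" by (rule sets_eq_imp_space_eq) (rule sets_\<pi>)
  have \<sigma>2: "\<sigma>\<^sup>2 > 0" using \<open>\<sigma> > 0\<close> by simp
  note gam = smaller_root_temperature_equation[OF \<open>\<sigma> > 0\<close> \<beta> \<gamma>]
  interpret affine_aggregation M \<pi> f0 b W A c pen \<sigma> \<beta> \<gamma>
  proof (intro affine_aggregation.intro affine_aggregation_axioms.intro)
    show "prob_space M" "prob_space \<pi>" by fact+
    show "W \<in> borel_measurable M" by fact
    show "A \<in> borel_measurable \<pi>" "c \<in> borel_measurable \<pi>" "pen \<in> borel_measurable \<pi>"
      using A_meas c_meas pen_meas measurable_cong_sets[OF sets_\<pi> refl] by blast+
    show "(\<integral>\<^sup>+\<omega>. ennreal (exp (v \<bullet> W \<omega>)) \<partial>M) \<le> ennreal (exp (\<sigma>\<^sup>2 / 2 * (norm v)\<^sup>2))" for v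
      using W_subgauss[of v] by (subst nn_integral_eq_integral) (auto intro: ennreal_leI)
    show "pos_semidef (A t)" if "t \<in> space \<pi>" for t
      using A_psd that space_\<pi> by simp
    show "norm (A t *v x) \<le> norm x" if "t \<in> space \<pi>" for t x
    proof -
      have "ereal (onorm (\<lambda>x. A t *v x)) \<le> (SUP t\<in>space T. ereal (onorm (\<lambda>x. A t *v x)))"
        using that space_\<pi> by (intro SUP_upper) simp
      then have "ereal (onorm (\<lambda>x. A t *v x)) \<le> 1" using A_norm by (rule order_trans)
      then have "onorm (\<lambda>x. A t *v x) \<le> 1" by simp
      then have "onorm (\<lambda>x. A t *v x) * norm x \<le> 1 * norm x" by (intro mult_right_mono) auto
      moreover have "norm (A t *v x) \<le> onorm (\<lambda>x. A t *v x) * norm x"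
        by (intro onorm matrix_vector_mul_bounded_linear)
      ultimately show ?thesis by simp
    qed
    show "pen t \<ge> 4 * \<sigma>\<^sup>2 / (\<beta> - 4 * \<sigma>\<^sup>2) * \<sigma>\<^sup>2 * trace (A t ** A t)" if "t \<in> space \<pi>" for t
      using pen that space_\<pi> by simp
    show "\<beta> > 4 * \<sigma>\<^sup>2" using \<beta> \<sigma>2 by linarith
    show "0 < \<gamma>" "2 * \<gamma> < 1" "2 * \<sigma>\<^sup>2 * (1 + 2 * \<gamma>)\<^sup>2 \<le> \<gamma> * (\<beta> - 4 * \<sigma>\<^sup>2)"
      using gam by auto
  qed
  have \<mu>: "prob_space \<mu>" "sets \<mu> = sets \<pi>" if "\<mu> \<in> space (prob_algebra T)" for \<mu>
    using that sets_\<pi> by (auto simp: space_prob_algebra)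
  have a: "1 + 4 * \<gamma> / (1 - 2 * \<gamma>) > 0" and b: "1 + 2 * \<gamma> / (1 - 2 * \<gamma>) > 0"
    using gam by (auto intro!: add_pos_nonneg)
  \<comment> \<open>Outside an event of probability at most \<open>\<eta>\<close>, given by Markov's inequality, \<open>pair_moment\<close> is below
    \<open>1 / \<eta>\<close>, and there the bound holds for all \<open>\<mu>\<close> simultaneously.\<close>
  have "1 - \<eta> \<le> measure M {\<omega> \<in> space M. ereal (agg_loss \<omega>)
        \<le> (INF \<mu>\<in>space (prob_algebra T).
            ereal (1 + 4 * \<gamma> / (1 - 2 * \<gamma>)) * enn2ereal (\<integral>\<^sup>+ t. ennreal (loss \<omega> t) \<partial>\<mu>)
          + ereal (1 + 2 * \<gamma> / (1 - 2 * \<gamma>)) * enn2ereal (\<integral>\<^sup>+ t. ennreal (cost t) \<partial>\<mu>)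
          + ereal (\<beta> * (1 + 2 * \<gamma> / (1 - 2 * \<gamma>))) * (2 * kl_div \<mu> \<pi> + ereal (ln (1 / \<eta>))))}"
    (is "_ \<le> measure M {\<omega> \<in> space M. _ \<le> ?bound \<omega>}")
    if \<eta>: "0 < \<eta>" "\<eta> \<le> 1" for \<eta> :: real
  proof -
    let ?C = "\<lambda>\<mu>. ereal (1 + 2 * \<gamma> / (1 - 2 * \<gamma>)) * enn2ereal (\<integral>\<^sup>+ t. ennreal (cost t) \<partial>\<mu>)
          + ereal (\<beta> * (1 + 2 * \<gamma> / (1 - 2 * \<gamma>))) * (2 * kl_div \<mu> \<pi> + ereal (ln (1 / \<eta>)))"
    let ?h = "\<lambda>w t. f0 - affine_est A b c (f0 + w) t"
    let ?G = "\<lambda>\<mu> w. ereal (1 + 4 * \<gamma> / (1 - 2 * \<gamma>))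
        * enn2ereal (\<integral>\<^sup>+ t. ennreal ((norm (?h w t))\<^sup>2) \<partial>\<mu>) + ?C \<mu>"
    have "(\<lambda>w. INF \<mu>\<in>space (prob_algebra T). ?G \<mu> w) \<in> borel_measurable borel"
    proof (rule borel_measurable_INF_upper_semicontinuous, rule open_mean_square_sublevel)
      fix \<mu> assume \<mu>T: "\<mu> \<in> space (prob_algebra T)"
      note [measurable_cong] = \<mu>(2)[OF \<mu>T]
      show "prob_space \<mu>" by (rule \<mu>(1)[OF \<mu>T])
      show "?h w \<in> borel_measurable \<mu>" for w unfolding affine_est_def by measurable
      show "1 + 4 * \<gamma> / (1 - 2 * \<gamma>) > 0" by (rule a)
      show "norm (?h w t - ?h w' t) \<le> norm (w - w')" if "t \<in> space \<mu>" for w w' t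
      proof -
        have "?h w t - ?h w' t = A t *v (w' - w)"
          by (simp add: affine_est_def matrix_vector_mult_diff_distrib matrix_vector_right_distrib)
        then show ?thesis
          using contraction[of t "w' - w"] that sets_eq_imp_space_eq[OF \<mu>(2)[OF \<mu>T]]
          by (simp add: norm_minus_commute)
      qed
      show "?C \<mu> \<noteq> -\<infinity>"
      proof -
        have "ereal (\<beta> * (1 + 2 * \<gamma> / (1 - 2 * \<gamma>))) * (2 * kl_div \<mu> \<pi> + ereal (ln (1 / \<eta>))) \<noteq> -\<infinity>"
          by (rule kl_div_cases[OF \<mu>[OF \<mu>T]]) (use b \<beta>_pos in auto)
        moreover have "ereal (1 + 2 * \<gamma> / (1 - 2 * \<gamma>)) * enn2ereal (\<integral>\<^sup>+ t. ennreal (cost t) \<partial>\<mu>) \<noteq> -\<infinity>"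
          using b by (cases "enn2ereal (\<integral>\<^sup>+ t. ennreal (cost t) \<partial>\<mu>)") auto
        ultimately show ?thesis by (simp add: ereal_plus_eq_MInfty)
      qed
    qed
    then have "(\<lambda>\<omega>. INF \<mu>\<in>space (prob_algebra T). ?G \<mu> (W \<omega>)) \<in> borel_measurable M"
      by (rule measurable_compose[OF W_meas])
    then have bound_meas: "?bound \<in> borel_measurable M" by (simp only: add.assoc)
    have "emeasure M {\<omega> \<in> space M. 1 \<le> ennreal \<eta> * pair_moment \<omega>}
        \<le> ennreal \<eta> * (\<integral>\<^sup>+\<omega>. pair_moment \<omega> * indicator (space M) \<omega> \<partial>M)"
      by (intro nn_integral_Markov_inequality) auto
    also have "\<dots> = ennreal \<eta> * (\<integral>\<^sup>+\<omega>. pair_moment \<omega> \<partial>M)"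
      by (intro arg_cong2[where f = "(*)"] nn_integral_cong refl) auto
    also have "\<dots> \<le> ennreal \<eta> * 1" by (intro mult_left_mono expectation_pair_moment_le_1) auto
    finally have markov: "measure M {\<omega> \<in> space M. 1 \<le> ennreal \<eta> * pair_moment \<omega>} \<le> \<eta>"
      using \<eta> by (simp add: M.emeasure_eq_measure)
    have "1 - \<eta> \<le> 1 - measure M {\<omega> \<in> space M. 1 \<le> ennreal \<eta> * pair_moment \<omega>}" using markov by simp
    also have "\<dots> = measure M (space M - {\<omega> \<in> space M. 1 \<le> ennreal \<eta> * pair_moment \<omega>})"
      by (subst M.prob_compl) auto
    also have "\<dots> \<le> measure M {\<omega> \<in> space M. ereal (agg_loss \<omega>) \<le> ?bound \<omega>}"
    proof (rule M.finite_measure_mono)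
      show "space M - {\<omega> \<in> space M. 1 \<le> ennreal \<eta> * pair_moment \<omega>}
          \<subseteq> {\<omega> \<in> space M. ereal (agg_loss \<omega>) \<le> ?bound \<omega>}"
      proof
        fix \<omega> assume "\<omega> \<in> space M - {\<omega> \<in> space M. 1 \<le> ennreal \<eta> * pair_moment \<omega>}"
        then have \<omega>: "\<omega> \<in> space M" and "ennreal \<eta> * pair_moment \<omega> \<le> 1" by auto
        from this(2) have "ennreal (1 / \<eta>) * (ennreal \<eta> * pair_moment \<omega>) \<le> ennreal (1 / \<eta>) * 1"
          by (intro mult_left_mono) auto
        then have "pair_moment \<omega> \<le> ennreal (1 / \<eta>)"
          using \<eta> by (simp add: mult.assoc[symmetric] ennreal_mult'[symmetric])
        then have "ereal (agg_loss \<omega>) \<le> ?bound \<omega>"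
          by (intro INF_greatest agg_loss_le_of_pair_moment_le \<omega> \<mu> \<eta>(1))
        with \<omega> show "\<omega> \<in> {\<omega> \<in> space M. ereal (agg_loss \<omega>) \<le> ?bound \<omega>}" by (intro CollectI conjI)
      qed
      show "{\<omega> \<in> space M. ereal (agg_loss \<omega>) \<le> ?bound \<omega>} \<in> sets M"
        by (rule borel_measurable_le[OF _ bound_meas]) measurable
    qed
    finally show ?thesis .
  qed
  moreover have "enn2ereal (\<integral>\<^sup>+ \<omega>. ennreal (agg_loss \<omega>) \<partial>M)
        \<le> (INF \<mu>\<in>space (prob_algebra T).
            ereal (1 + 4 * \<gamma> / (1 - 2 * \<gamma>))
              * enn2ereal (\<integral>\<^sup>+ t. (\<integral>\<^sup>+ \<omega>. ennreal (loss \<omega> t) \<partial>M) \<partial>\<mu>)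
          + ereal (1 + 2 * \<gamma> / (1 - 2 * \<gamma>)) * enn2ereal (\<integral>\<^sup>+ t. ennreal (cost t) \<partial>\<mu>)
          + ereal (2 * \<beta> * (1 + 2 * \<gamma> / (1 - 2 * \<gamma>))) * kl_div \<mu> \<pi>)"
    by (intro INF_greatest expectation_agg_loss_le \<mu>)
  ultimately show ?thesis by blast
qed

end
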